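(* Let $\mu$ be a probability measure on $\mathbb R$ and let $f(s)=\sum_{n\ge1}a_nn^{-s}$ be a Dirichlet series in $\mathcal N_u$ with $f\not\equiv0$. Then $$\|f\|_0\asymp\log(1+|f_\chi(+\infty)|)+4\int_{\mathbb T^\infty}\int_0^\infty\int_{\mathbb R}\frac{|f_\chi'(\sigma+it)|^2}{|f_\chi(\sigma+it)|\,(1+|f_\chi(\sigma+it)|)^2}\,\sigma\,d\mu(t)\,d\sigma\,dm_\infty(\chi).$$
   Context: For $\theta\in\mathbb R$ put $\mathbb C_\theta=\{s\in\mathbb C:\operatorname{Re}s>\theta\}$. A Dirichlet series is a series $f(s)=\sum_{n\ge1}a_nn^{-s}$; its abscissa of uniform convergence $\sigma_u(f)$ is the infimum of all $\theta\in\mathbb R$ such that the series converges uniformly on $\mathbb C_\theta$. The Nevanlinna class of Dirichlet series $\mathcal N_u$ consists of all Dirichlet series $f$ with $\sigma_u(f)\le0$ and $\limsup_{\sigma\to0^+}\lim_{T\to\infty}\frac1{2T}\int_{-T}^T\log^+|f(\sigma+it)|\,dt<\infty$, where $\log^+x=\max\{\log x,0\}$; such $f$ are holomorphic on $\mathbb C_0$. For $f\in\mathcal N_u$, $\|f\|_0=\limsup_{\sigma\to0^+}\lim_{T\to\infty}\frac1{2T}\int_{-T}^T\log(1+|f(\sigma+it)|)\,dt$. $\mathbb T^\infty$ is the countably infinite product of unit circles with normalized Haar measure $m_\infty$. A point $\chi=(\chi_1,\chi_2,\dots)\in\mathbb T^\infty$ is identified with the completely multiplicative function $\chi:\mathbb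 N\to\mathbb T$ with $\chi(p_j)=\chi_j$, $p_j$ the $j$-th prime. The vertical limit function of $f$ is $f_\chi(s)=\sum_na_n\chi(n)n^{-s}$ (holomorphic on $\mathbb C_0$), and $f_\chi(+\infty)=a_1=f(+\infty)$ for every $\chi$. The notation $A\asymp B$ for two real quantities depending on $f$ means that there is a constant $C\ge1$, independent of $f$, with $C^{-1}A\le B\le CA$. The integrand is understood off the zero set of $f_\chi$. *)

theory Defs
  imports
    "HOL-Probability.Probability"
    "HOL-Computational_Algebra.Primes"
    "HOL-Library.Infinite_Set"
begin

section \<open>Dirichlet series\<close>

text \<open>A Dirichlet series is represented by its coefficient sequence \<open>a 1, a 2, \<dots>\<close>;
  the value \<open>a 0\<close> is never used. The sum is the limit of the partial sums in the natural order,
  as the convergence is in general only conditional.\<close>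

definition dterm :: "(nat \<Rightarrow> complex) \<Rightarrow> nat \<Rightarrow> complex \<Rightarrow> complex" where
  "dterm a n s = a n * of_nat n powr (- s)"

definition dseries :: "(nat \<Rightarrow> complex) \<Rightarrow> complex \<Rightarrow> complex" where
  "dseries a s = (\<Sum>n. dterm a (Suc n) s)"

definition right_half_plane :: "real \<Rightarrow> complex set" where
  "right_half_plane \<theta> = {s. Re s > \<theta>}"

definition abscissa_unif_conv :: "(nat \<Rightarrow> complex) \<Rightarrow> ereal" where
  "abscissa_unif_conv a =
     Inf (ereal ` {\<theta>. uniformly_convergent_on (right_half_plane \<theta>)
                        (\<lambda>N s. \<Sum>n=1..N. dterm a n s)})"

definition dseries_at_infinity :: "(nat \<Rightarrow> complex) \<Rightarrow> complex" where
  "dseries_at_infinity a = Lim at_top (\<lambda>\<sigma>::real. dseries a (of_real \<sigma>))"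


section \<open>The Nevanlinna class\<close>

text \<open>Since \<open>ln 0 = 0\<close> in HOL, this also gives the correct value \<open>0\<close> at \<open>x = 0\<close>.\<close>

definition log_plus :: "real \<Rightarrow> real" where
  "log_plus x = max (ln x) 0"

text \<open>For \<open>\<sigma>\<^sub>u(f) \<le> 0\<close> and \<open>\<sigma> > 0\<close> the function \<open>t \<mapsto> f(\<sigma> + i t)\<close> is almost periodic, so the
  limit below exists for continuous \<open>\<Phi>\<close>.\<close>

definition vertical_mean :: "(real \<Rightarrow> real) \<Rightarrow> (nat \<Rightarrow> complex) \<Rightarrow> real \<Rightarrow> real" where
  "vertical_mean \<Phi> a \<sigma> =
     Lim at_top (\<lambda>T. 1 / (2 * T) * (LBINT t:{-T..T}. \<Phi> (cmod (dseries a (Complex \<sigma> t)))))"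

definition nevanlinna_class :: "(nat \<Rightarrow> complex) set" where
  "nevanlinna_class =
     {a. abscissa_unif_conv a \<le> 0 \<and>
         Limsup (at_right 0) (\<lambda>\<sigma>. ereal (vertical_mean log_plus a \<sigma>)) < \<infinity>}"

definition nevanlinna_norm :: "(nat \<Rightarrow> complex) \<Rightarrow> ereal" where
  "nevanlinna_norm a =
     Limsup (at_right 0) (\<lambda>\<sigma>. ereal (vertical_mean (\<lambda>x. ln (1 + x)) a \<sigma>))"


section \<open>The infinite torus and vertical limit functions\<close>

definition circle_haar :: "complex measure" where
  "circle_haar =
     distr (uniform_measure lborel {0..1}) (restrict_space borel (sphere 0 1))
       (\<lambda>x::real. cis (2 * pi * x))"

text \<open>The normalized Haar measure of a countable product of compact metrizable groups is the
  product of the normalized Haar measures.\<close>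

definition torus_haar :: "(nat \<Rightarrow> complex) measure" where
  "torus_haar = PiM UNIV (\<lambda>_. circle_haar)"

text \<open>Points of the torus are called \<open>\<omega>\<close>, since the letter chi is a binder in HOL-Analysis.
  Coordinates are numbered from \<open>0\<close>, so \<open>nth_prime 0 = 2\<close>.\<close>

definition nth_prime :: "nat \<Rightarrow> nat" where
  "nth_prime j = enumerate {p. prime p} j"

text \<open>Only used for \<open>n \<ge> 1\<close>, where the product is finite.\<close>

definition char_ext :: "(nat \<Rightarrow> complex) \<Rightarrow> nat \<Rightarrow> complex" where
  "char_ext \<omega> n = (\<Prod>j | nth_prime j dvd n. \<omega> j ^ multiplicity (nth_prime j) n)"

definition twist :: "(nat \<Rightarrow> complex) \<Rightarrow> (nat \<Rightarrow> complex) \<Rightarrow> nat \<Rightarrow> complex" where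
  "twist a \<omega> n = a n * char_ext \<omega> n"

abbreviation vertical_limit :: "(nat \<Rightarrow> complex) \<Rightarrow> (nat \<Rightarrow> complex) \<Rightarrow> complex \<Rightarrow> complex" where
  "vertical_limit a \<omega> \<equiv> dseries (twist a \<omega>)"


section \<open>The area integral\<close>

text \<open>The nonnegative integrand is integrated with values in \<open>[0, \<infinity>]\<close>, so integrability is not
  presupposed.\<close>

definition area_integral :: "real measure \<Rightarrow> (nat \<Rightarrow> complex) \<Rightarrow> ennreal" where
  "area_integral \<mu> a =
     (\<integral>\<^sup>+ \<omega>. (\<integral>\<^sup>+ \<sigma>\<in>{0<..}.
        (\<integral>\<^sup>+ t\<in>{t. vertical_limit a \<omega> (Complex \<sigma> t) \<noteq> 0}.
           ennreal ((cmod (deriv (vertical_limit a \<omega>) (Complex \<sigma> t)))\<^sup>2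
             / (cmod (vertical_limit a \<omega> (Complex \<sigma> t))
                * (1 + cmod (vertical_limit a \<omega> (Complex \<sigma> t)))\<^sup>2) * \<sigma>)
         \<partial>\<mu>) \<partial>lborel) \<partial>torus_haar)"


section \<open>Consistency of the conventions\<close>

lemma prob_space_circle_haar: "prob_space circle_haar"
proof -
  have "prob_space (uniform_measure lborel {0..1::real})"
    by (rule prob_space_uniform_measure) auto
  moreover have "(\<lambda>x::real. cis (2 * pi * x))
      \<in> uniform_measure lborel {0..1} \<rightarrow>\<^sub>M restrict_space borel (sphere 0 1)"
    by (intro measurable_restrict_space2)
      (auto intro!: borel_measurable_continuous_onI continuous_intros
            simp: cong: measurable_cong_sets)
  ultimately show ?thesis
    unfolding circle_haar_def by (rule prob_space.prob_space_distr)
qed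

lemma space_torus_haar: "space torus_haar = {\<omega>. \<forall>j. cmod (\<omega> j) = 1}"
  by (auto simp: torus_haar_def circle_haar_def space_PiM space_restrict_space PiE_def
      extensional_def Pi_def)

lemma nth_prime_prime: "prime (nth_prime j)"
  unfolding nth_prime_def using enumerate_in_set[OF primes_infinite] by simp

lemma inj_nth_prime: "inj nth_prime"
  using strict_mono_enumerate[OF primes_infinite] 
  by (simp add: nth_prime_def[abs_def] strict_mono_imp_inj_on)

lemma finite_nth_prime_dvd:
  assumes "n > 0" shows "finite {j. nth_prime j dvd n}"
proof -
  have "finite (nth_prime ` {j. nth_prime j dvd n})"
    by (rule finite_subset[of _ "{..n}"]) (use assms in \<open>auto intro: dvd_imp_le\<close>)
  then show ?thesis
    by (rule finite_imageD) (use inj_nth_prime in \<open>auto intro: inj_on_subset\<close>)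
qed

lemma char_ext_nth_prime: "char_ext \<omega> (nth_prime j) = \<omega> j"
proof -
  have "{i. nth_prime i dvd nth_prime j} = {j}"
    using nth_prime_prime inj_nth_prime by (auto simp: primes_dvd_imp_eq inj_def)
  then show ?thesis
    using nth_prime_prime[of j] by (simp add: char_ext_def prime_nat_iff)
qed

lemma char_ext_mult:
  assumes "m > 0" "n > 0"
  shows "char_ext \<omega> (m * n) = char_ext \<omega> m * char_ext \<omega> n"
proof -
  define A where "A = {j. nth_prime j dvd m * n}"
  have fin: "finite A"
    unfolding A_def by (rule finite_nth_prime_dvd) (use assms in simp)
  have ext: "char_ext \<omega> k = (\<Prod>j\<in>A. \<omega> j ^ multiplicity (nth_prime j) k)"
    if "k dvd m * n" for k
    unfolding char_ext_def
    by (rule prod.mono_neutral_left)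
      (use fin that in \<open>auto simp: A_def not_dvd_imp_multiplicity_0 intro: dvd_trans\<close>)
  have "char_ext \<omega> (m * n) =
      (\<Prod>j\<in>A. \<omega> j ^ multiplicity (nth_prime j) m * \<omega> j ^ multiplicity (nth_prime j) n)"
    unfolding ext[OF dvd_refl]
    by (rule prod.cong)
      (use assms nth_prime_prime in \<open>auto simp: prime_elem_multiplicity_mult_distrib power_add\<close>)
  then show ?thesis
    by (simp add: ext prod.distrib)
qed

end

theory Submission
  imports Defs "HOL-Complex_Analysis.Complex_Analysis"
begin

text \<open>Write \<open>M(\<sigma>)\<close> for the integral over the torus of \<open>ln (1 + |f\<^sub>\<omega>(\<sigma>)|)\<close>, where \<open>f\<^sub>\<omega>\<close> is the vertical
limit function of \<open>f\<close>. The proof rests on the identity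
\[ M(c) - \log(1+|a_1|) = \int_{T^\infty} \int_c^\infty
     \frac{|f_\omega'(x)|^2}{|f_\omega(x)|(1+|f_\omega(x)|)^2} (x - c)\,dx\,dm(\omega), \]
which holds without any constant. As \<open>c\<close> decreases to \<open>0\<close>, both sides increase; the left side tends to
\<open>nevanlinna_norm a - ln (1 + |a\<^sub>1|)\<close> and the right side to the area integral \<open>I\<close>. So the norm is
\<open>L + I\<close> with \<open>L = ln (1 + |a\<^sub>1|)\<close>, the right side of the theorem is \<open>L + 4 I\<close>, and the
theorem holds with the constant \<open>4\<close>.

Three facts make this work.

The rotations \<open>flow t\<close>, that multiply the coordinate of the prime \<open>p\<close> by \<open>p\<^sup>-\<^sup>i\<^sup>t\<close>, preserve Haar measure
and translate \<open>f\<^sub>\<omega>\<close> vertically by \<open>t\<close> (\<open>vertical_limit_flow\<close>). Therefore torus integrals of expressions in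
\<open>f\<^sub>\<omega>(\<sigma> + i t)\<close> and its derivatives do not depend on \<open>t\<close>, and \<open>\<mu>\<close> disappears from the area integral
(\<open>area_integral_eq\<close>).

The orbit of the point \<open>(1, 1, \<dots>)\<close> under this flow is dense by Kronecker's theorem, so the uniform
convergence of the series of \<open>f\<close> carries over to all \<open>f\<^sub>\<omega>\<close> with the same bounds (\<open>uniform_limit_torus\<close>),
and the orbit is equidistributed, so vertical means of \<open>f\<close> are torus integrals (\<open>vertical_mean_eq\<close>).

Finally, \<open>ln (1 + |f|)\<close> has Laplacian \<open>|f'|\<^sup>2 / (|f| (1 + |f|)\<^sup>2)\<close> away from the zeros of \<open>f\<close>. In the
torus integral of the Laplacian the second vertical derivative contributes \<open>0\<close>, by invariance
(\<open>integral_D2_vertical\<close>), so the integral of the Laplacian is \<open>M''\<close>, and the identity is Taylor's formula at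
infinity for \<open>M\<close>. To avoid the zeros, this is carried out for \<open>ln (1 + sqrt (e\<^sup>2 + |f|\<^sup>2))\<close>
(\<open>regular_mean_identity\<close>). For \<open>e \<le> 1\<close> the Laplacian of this function is almost everywhere
at most \<open>4\<close> times the limit kernel, and so \<open>e\<close> can tend to \<open>0\<close> by dominated convergence, once
Fatou's lemma has shown that the limit integral is finite (\<open>log_mean_identity\<close>).\<close>

section \<open>Rotations of the torus and the vertical flow\<close>

lemma emeasure_lborel_translate:
  assumes "X \<in> sets borel"
  shows "emeasure lborel {x::real. x + c \<in> X} = emeasure lborel X"
proof -
  have "emeasure lborel X = emeasure (distr lborel borel ((+) c)) X"
    by (simp add: lborel_distr_plus)
  also have "\<dots> = emeasure lborel {x. x + c \<in> X}"
    using assms by (subst emeasure_distr) (auto simp: vimage_def add.commute)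
  finally show ?thesis ..
qed

text \<open>After translation the window \<open>[0, 1]\<close> becomes \<open>[c, 1 + c]\<close>; by periodicity the part beyond \<open>1\<close>
can be moved back to \<open>[0, c]\<close>.\<close>

lemma emeasure_periodic_translate:
  fixes B :: "real set"
  assumes B: "B \<in> sets borel" and per: "\<And>x. x + 1 \<in> B \<longleftrightarrow> x \<in> B"
    and c: "0 \<le> c" "c \<le> 1"
  shows "emeasure lborel ({0..1} \<inter> {x. x + c \<in> B}) = emeasure lborel ({0..1} \<inter> B)"
proof -
  \<comment> \<open>The two closed intervals overlap in the null set \<open>{y}\<close>.\<close>
  have split: "emeasure lborel ({x..z} \<inter> B) = emeasure lborel ({x..y} \<inter> B) + emeasure lborel ({y..z} \<inter> B)"
    if "x \<le> y" "y \<le> z" for x y z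
  proof -
    define X Y where "X = {x..y} \<inter> B" and "Y = {y<..z} \<inter> B"
    have "emeasure lborel X + emeasure lborel Y = emeasure lborel (X \<union> Y)"
      using B by (intro plus_emeasure) (auto simp: X_def Y_def)
    moreover have "X \<union> Y = {x..z} \<inter> B" using that by (auto simp: X_def Y_def)
    moreover have "emeasure lborel Y = emeasure lborel ({y..z} \<inter> B)"
    proof -
      have "emeasure lborel (({y..z} \<inter> B) - {y}) = emeasure lborel ({y..z} \<inter> B)"
        using B by (intro emeasure_Diff_null_set) (auto simp: null_sets_def)
      moreover have "({y..z} \<inter> B) - {y} = Y" by (auto simp: Y_def)
      ultimately show ?thesis by simp
    qed
    ultimately show ?thesis by (simp add: X_def)
  qed
  have "{0..1} \<inter> {x. x + c \<in> B} = {x. x + c \<in> {c..1+c} \<inter> B}" by auto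
  then have "emeasure lborel ({0..1} \<inter> {x. x + c \<in> B}) = emeasure lborel ({c..1+c} \<inter> B)"
    using B by (simp add: emeasure_lborel_translate del: Int_iff)
  also have "\<dots> = emeasure lborel ({c..1} \<inter> B) + emeasure lborel ({1..1+c} \<inter> B)"
    using c by (intro split) auto
  also have "emeasure lborel ({1..1+c} \<inter> B) = emeasure lborel {x. x + 1 \<in> {1..1+c} \<inter> B}"
    using B by (intro emeasure_lborel_translate[symmetric]) auto
  also have "{x. x + 1 \<in> {1..1+c} \<inter> B} = {0..c} \<inter> B"
    using per by auto
  also have "emeasure lborel ({c..1} \<inter> B) + emeasure lborel ({0..c} \<inter> B) = emeasure lborel ({0..1} \<inter> B)"
    using c split[of 0 c 1] by (simp add: add.commute)
  finally show ?thesis .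
qed

lemma sets_circle_haar [measurable_cong]: "sets circle_haar = sets (restrict_space borel (sphere 0 1))"
  and space_circle_haar: "space circle_haar = sphere 0 1"
  by (simp_all add: circle_haar_def space_restrict_space)

lemma measurable_circle_rotation:
  assumes "cmod c = 1"
  shows "(\<lambda>z. c * z) \<in> circle_haar \<rightarrow>\<^sub>M circle_haar"
proof -
  have "(\<lambda>z. c * z) \<in> restrict_space borel (sphere 0 1) \<rightarrow>\<^sub>M restrict_space borel (sphere 0 1)"
    using assms
    by (intro measurable_restrict_space2 measurable_restrict_space1)
       (auto simp: norm_mult space_restrict_space)
  then show ?thesis
    by (simp cong: measurable_cong_sets add: sets_circle_haar)
qed

lemma measurable_cis_circle:
  "(\<lambda>x::real. cis (2 * pi * x)) \<in> uniform_measure lborel {0..1} \<rightarrow>\<^sub>M restrict_space borel (sphere 0 1)"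
  by (intro measurable_restrict_space2)
     (auto intro!: borel_measurable_continuous_onI continuous_intros cong: measurable_cong_sets)

lemma circle_haar_rotation:
  assumes "cmod c = 1"
  shows "distr circle_haar circle_haar (\<lambda>z. c * z) = circle_haar"
proof (rule measure_eqI)
  fix A assume "A \<in> sets (distr circle_haar circle_haar (\<lambda>z. c * z))"
  then have A: "A \<in> sets circle_haar" by simp
  then have A': "A \<in> sets (restrict_space borel (sphere 0 1))" by (simp add: sets_circle_haar)
  define \<theta> where "\<theta> = Arg2pi c / (2 * pi)"
  have \<theta>: "0 \<le> \<theta>" "\<theta> \<le> 1"
    using Arg2pi[of c] by (auto simp: \<theta>_def)
  have c: "c = cis (2 * pi * \<theta>)"
    using Arg2pi[of c] assms by (simp add: \<theta>_def cis_conv_exp is_Arg_def)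
  define B where "B = {x. cis (2 * pi * x) \<in> A}"
  have meas: "(\<lambda>x::real. cis (2 * pi * x)) \<in> borel \<rightarrow>\<^sub>M restrict_space borel (sphere 0 1)"
    using measurable_cis_circle by (simp cong: measurable_cong_sets)
  have B: "B \<in> sets borel"
    using measurable_sets[OF meas A'] by (simp add: B_def vimage_def)
  have per: "x + 1 \<in> B \<longleftrightarrow> x \<in> B" for x
    by (simp add: B_def distrib_left flip: cis_mult)
  have em: "emeasure circle_haar X = emeasure lborel ({0..1} \<inter> {x. cis (2 * pi * x) \<in> X})"
    if "X \<in> sets circle_haar" for X
  proof -
    have X: "X \<in> sets (restrict_space borel (sphere 0 1))" using that by (simp add: sets_circle_haar)
    have "{x::real. cis (2 * pi * x) \<in> X} \<in> sets borel"
      using measurable_sets[OF meas X] by (simp add: vimage_def)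
    then show ?thesis unfolding circle_haar_def
      using X by (subst emeasure_distr[OF measurable_cis_circle])
         (auto simp: vimage_def divide_ennreal_def)
  qed
  have "emeasure (distr circle_haar circle_haar (\<lambda>z. c * z)) A
      = emeasure circle_haar ((\<lambda>z. c * z) -` A \<inter> space circle_haar)"
    using A by (rule emeasure_distr[OF measurable_circle_rotation[OF assms]])
  also have "\<dots> = emeasure lborel ({0..1} \<inter> {x. x + \<theta> \<in> B})"
    by (subst em[OF measurable_sets[OF measurable_circle_rotation[OF assms] A]])
       (simp add: B_def c cis_mult space_circle_haar distrib_left add.commute)
  also have "\<dots> = emeasure circle_haar A"
    using emeasure_periodic_translate[OF B per \<theta>] em[OF A] by (simp add: B_def)
  finally show "emeasure (distr circle_haar circle_haar (\<lambda>z. c * z)) A = emeasure circle_haar A" .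
qed simp

interpretation torus: prob_space torus_haar
  unfolding torus_haar_def by (rule prob_space_PiM) (rule prob_space_circle_haar)

lemma measurable_torus_coord [measurable]: "(\<lambda>\<omega>. \<omega> j) \<in> borel_measurable torus_haar"
proof -
  have "(\<lambda>\<omega>. \<omega> j) \<in> torus_haar \<rightarrow>\<^sub>M circle_haar"
    unfolding torus_haar_def by simp
  moreover have "(\<lambda>z. z) \<in> circle_haar \<rightarrow>\<^sub>M (borel :: complex measure)"
    by (subst measurable_cong_sets[OF sets_circle_haar refl]) (auto intro: measurable_restrict_space1)
  ultimately show ?thesis by (rule measurable_compose)
qed

lemma measurable_torus_rotation:
  assumes "\<And>j. cmod (c j) = 1"
  shows "(\<lambda>\<omega> j. c j * \<omega> j) \<in> torus_haar \<rightarrow>\<^sub>M torus_haar"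
  unfolding torus_haar_def
proof (rule measurable_PiM_single')
  fix j
  show "(\<lambda>\<omega>. c j * \<omega> j) \<in> Pi\<^sub>M UNIV (\<lambda>_. circle_haar) \<rightarrow>\<^sub>M circle_haar"
    by (rule measurable_compose[OF _ measurable_circle_rotation[OF assms]]) simp
qed (use assms in \<open>auto simp: space_PiM space_circle_haar PiE_def Pi_def extensional_def norm_mult\<close>)

text \<open>It suffices to compare both measures on cylinder sets, where the claim is the invariance of each factor.\<close>

lemma torus_haar_rotation:
  assumes c: "\<And>j. cmod (c j) = 1"
  shows "distr torus_haar torus_haar (\<lambda>\<omega> j. c j * \<omega> j) = torus_haar"
proof -
  interpret circle: prob_space circle_haar by (rule prob_space_circle_haar)
  interpret product_prob_space "\<lambda>_::nat. circle_haar" UNIV by unfold_locales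
  show ?thesis
    unfolding torus_haar_def
  proof (rule PiM_eq)
    fix J :: "nat set" and F assume J: "finite J" and F: "\<And>j. j \<in> J \<Longrightarrow> F j \<in> sets circle_haar"
    let ?R = "\<lambda>\<omega> j. c j * \<omega> j" and ?T = "PiM UNIV (\<lambda>_::nat. circle_haar)"
    have meas: "?R \<in> ?T \<rightarrow>\<^sub>M ?T"
      using measurable_torus_rotation[OF c] by (simp add: torus_haar_def)
    define G where "G j = (\<lambda>z. c j * z) -` F j \<inter> space circle_haar" for j
    have G: "G j \<in> sets circle_haar" if "j \<in> J" for j
      unfolding G_def by (rule measurable_sets[OF measurable_circle_rotation[OF c] F[OF that]])
    have "emeasure (distr ?T ?T ?R) (prod_emb UNIV (\<lambda>_. circle_haar) J (Pi\<^sub>E J F))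
       = emeasure ?T (?R -` prod_emb UNIV (\<lambda>_. circle_haar) J (Pi\<^sub>E J F) \<inter> space ?T)"
      using J F by (intro emeasure_distr[OF meas] sets_PiM_I) auto
    also have "?R -` prod_emb UNIV (\<lambda>_. circle_haar) J (Pi\<^sub>E J F) \<inter> space ?T
       = prod_emb UNIV (\<lambda>_. circle_haar) J (Pi\<^sub>E J G)"
      using c by (auto simp: prod_emb_def space_PiM G_def PiE_iff space_circle_haar norm_mult)
    also have "emeasure ?T \<dots> = (\<Prod>j\<in>J. emeasure circle_haar (G j))"
      using J G by (intro emeasure_PiM_emb) auto
    also have "\<dots> = (\<Prod>j\<in>J. emeasure circle_haar (F j))"
    proof (rule prod.cong)
      fix j assume "j \<in> J"
      then have "emeasure circle_haar (G j) = emeasure (distr circle_haar circle_haar (\<lambda>z. c j * z)) (F j)"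
        unfolding G_def by (intro emeasure_distr[symmetric] measurable_circle_rotation c F)
      then show "emeasure circle_haar (G j) = emeasure circle_haar (F j)"
        using circle_haar_rotation[OF c] by simp
    qed simp
    finally show "emeasure (distr ?T ?T ?R) (prod_emb UNIV (\<lambda>_. circle_haar) J (Pi\<^sub>E J F))
       = (\<Prod>j\<in>J. emeasure circle_haar (F j))" .
  qed simp
qed

text \<open>The Kronecker flow, which moves the coordinate of the prime \<open>p\<close> by the phase \<open>p\<^sup>-\<^sup>i\<^sup>t\<close>.\<close>

definition flow :: "real \<Rightarrow> (nat \<Rightarrow> complex) \<Rightarrow> nat \<Rightarrow> complex" where
  "flow t \<omega> j = cis (- t * ln (nth_prime j)) * \<omega> j"

lemma flow_space [intro]: "\<omega> \<in> space torus_haar \<Longrightarrow> flow t \<omega> \<in> space torus_haar"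
  by (simp add: space_torus_haar flow_def norm_mult)

lemma measurable_flow [measurable]: "flow t \<in> torus_haar \<rightarrow>\<^sub>M torus_haar"
  unfolding flow_def[abs_def] by (rule measurable_torus_rotation) simp

lemma distr_flow: "distr torus_haar torus_haar (flow t) = torus_haar"
  unfolding flow_def[abs_def] by (rule torus_haar_rotation) simp

lemma nn_integral_flow:
  assumes "h \<in> borel_measurable torus_haar"
  shows "(\<integral>\<^sup>+ \<omega>. h (flow t \<omega>) \<partial>torus_haar) = (\<integral>\<^sup>+ \<omega>. h \<omega> \<partial>torus_haar)"
  using nn_integral_distr[OF measurable_flow[of t], of h] assms by (simp add: distr_flow)

lemma integral_flow:
  fixes h :: "_ \<Rightarrow> 'a :: {banach, second_countable_topology}"
  assumes "h \<in> borel_measurable torus_haar"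
  shows "(\<integral> \<omega>. h (flow t \<omega>) \<partial>torus_haar) = (\<integral> \<omega>. h \<omega> \<partial>torus_haar)"
  using integral_distr[OF measurable_flow[of t] assms] by (simp add: distr_flow)

lemma nth_prime_pos [simp]: "nth_prime j > 0" and nth_prime_gt_1: "nth_prime j > 1"
  using prime_gt_0_nat[OF nth_prime_prime[of j]] prime_gt_1_nat[OF nth_prime_prime[of j]] by auto

lemma range_nth_prime: "range nth_prime = {p. prime p}"
  unfolding nth_prime_def using range_enumerate[OF primes_infinite] by simp

lemma cmod_char_ext [simp]:
  assumes "\<omega> \<in> space torus_haar"
  shows "cmod (char_ext \<omega> n) = 1"
  using assms by (simp add: char_ext_def space_torus_haar prod_norm[symmetric] norm_power)

lemma char_ext_1 [simp]: "char_ext \<omega> (Suc 0) = 1"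
proof -
  have "{j. nth_prime j dvd Suc 0} = {}"
    using nth_prime_gt_1 by (auto simp: nat_dvd_1_iff_1) (metis less_irrefl)
  then show ?thesis by (simp add: char_ext_def)
qed

text \<open>The phases of the primes add up, with multiplicities, to \<open>- t ln n\<close> by unique factorisation.\<close>

lemma char_ext_flow:
  assumes "n > 0"
  shows "char_ext (flow t \<omega>) n = cis (- t * ln n) * char_ext \<omega> n"
proof -
  define A where "A = {j. nth_prime j dvd n}"
  have fin: "finite A" using finite_nth_prime_dvd[OF assms] by (simp add: A_def)
  have "nth_prime ` A = prime_factors n"
    using assms range_nth_prime by (auto simp: A_def prime_factors_dvd image_iff nth_prime_prime) 
  then have "n = (\<Prod>j\<in>A. nth_prime j ^ multiplicity (nth_prime j) n)"
    using prime_factorization_nat[OF assms] inj_nth_prime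
    by (metis (no_types, lifting) inj_on_subset prod.reindex_cong subset_UNIV)
  then have "real n = (\<Prod>j\<in>A. real (nth_prime j) ^ multiplicity (nth_prime j) n)"
    by (metis (no_types, lifting) of_nat_power of_nat_prod prod.cong)
  then have "ln (real n) = (\<Sum>j\<in>A. ln (real (nth_prime j) ^ multiplicity (nth_prime j) n))"
    using fin by (simp add: ln_prod)
  also have "\<dots> = (\<Sum>j\<in>A. multiplicity (nth_prime j) n * ln (nth_prime j))"
    by (intro sum.cong) (auto simp: ln_realpow)
  finally have ln: "ln (real n) = (\<Sum>j\<in>A. multiplicity (nth_prime j) n * ln (nth_prime j))" .
  have "char_ext (flow t \<omega>) n
      = (\<Prod>j\<in>A. cis (- t * ln (nth_prime j)) ^ multiplicity (nth_prime j) n) * char_ext \<omega> n"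
    by (simp add: char_ext_def flow_def A_def power_mult_distrib prod.distrib)
  also have "(\<Prod>j\<in>A. cis (- t * ln (nth_prime j)) ^ multiplicity (nth_prime j) n)
      = cis (\<Sum>j\<in>A. multiplicity (nth_prime j) n * (- t * ln (nth_prime j)))"
    unfolding cis_conv_exp by (simp add: exp_sum[OF fin] exp_of_nat_mult[symmetric] sum_distrib_left algebra_simps)
  also have "(\<Sum>j\<in>A. multiplicity (nth_prime j) n * (- t * ln (nth_prime j))) = - t * ln n"
    by (simp add: ln sum_distrib_left algebra_simps)
  finally show ?thesis .
qed

lemma of_nat_powr_neg:
  fixes s :: complex
  assumes "n > 0"
  shows "of_nat n powr (- s) = exp (- (s * of_real (ln (real n))))"
  using assms by (simp add: powr_def Ln_of_nat)

lemma dterm_twist_flow: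
  assumes "n > 0"
  shows "dterm (twist a (flow t \<omega>)) n s = dterm (twist a \<omega>) n (s + \<i> * t)"
proof -
  have "of_nat n powr (- (s + \<i> * t)) = of_nat n powr (- s) * cis (- t * ln n)"
    unfolding of_nat_powr_neg[OF assms] cis_conv_exp exp_add[symmetric]
    by (simp add: algebra_simps)
  then show ?thesis
    using assms by (simp add: dterm_def twist_def char_ext_flow mult_ac del: minus_add_distrib)
qed

text \<open>The equality already holds term by term.\<close>

lemma vertical_limit_flow:
  "vertical_limit a (flow t \<omega>) s = vertical_limit a \<omega> (s + \<i> * t)"
  by (simp add: dseries_def dterm_twist_flow)

lemma twist_one: "n > 0 \<Longrightarrow> twist a (\<lambda>_. 1) n = a n"
  by (simp add: twist_def char_ext_def)

lemma vertical_limit_one: "vertical_limit a (\<lambda>_. 1) = dseries a"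
  by (simp add: dseries_def dterm_def twist_one fun_eq_iff)

lemma one_in_torus [simp]: "(\<lambda>_. 1) \<in> space torus_haar"
  by (simp add: space_torus_haar)

section \<open>Kronecker approximation\<close>

text \<open>Exponentiating a vanishing integer combination, with the negative coefficients moved to the other
side, gives two prime factorisations of one number.\<close>

lemma ln_primes_independent:
  fixes c :: "nat \<Rightarrow> int"
  assumes S: "finite S" "\<And>p. p \<in> S \<Longrightarrow> prime p" and eq: "(\<Sum>p\<in>S. c p * ln (real p)) = 0"
    and p: "p \<in> S"
  shows "c p = 0"
proof -
  define A where "A = (\<Prod>p\<in>S. p ^ nat (c p))"
  define B where "B = (\<Prod>p\<in>S. p ^ nat (- c p))"
  have pos: "A > 0" "B > 0"
    using S by (auto simp: A_def B_def prime_gt_0_nat intro!: prod_pos)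
  have ln_prod': "ln (real (\<Prod>p\<in>S. p ^ f p)) = (\<Sum>p\<in>S. real (f p) * ln (real p))" for f :: "nat \<Rightarrow> nat"
  proof -
    have "ln (real (\<Prod>p\<in>S. p ^ f p)) = ln (\<Prod>p\<in>S. real p ^ f p)" by simp
    also have "\<dots> = (\<Sum>p\<in>S. ln (real p ^ f p))"
      using S by (intro ln_prod) (auto simp: prime_gt_0_nat)
    also have "\<dots> = (\<Sum>p\<in>S. real (f p) * ln (real p))"
      using S by (intro sum.cong) (auto simp: ln_realpow prime_gt_0_nat)
    finally show ?thesis .
  qed
  have "ln (real A) - ln (real B) = (\<Sum>p\<in>S. (real (nat (c p)) - real (nat (- c p))) * ln (real p))"
    unfolding A_def B_def ln_prod' by (simp add: sum_subtractf algebra_simps)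
  also have "\<dots> = (\<Sum>p\<in>S. c p * ln (real p))"
    by (intro sum.cong) auto
  finally have "A = B"
    using eq pos by simp
  then have "multiplicity p A = multiplicity p B" by simp
  then have "nat (c p) = nat (- c p)"
    using S p by (simp add: A_def B_def multiplicity_prod_prime_powers)
  then show ?thesis by linarith
qed

text \<open>Kronecker's theorem approximates finitely many coordinates at a time; the \<open>k\<close>-th time \<open>t k\<close> handles the
first \<open>k\<close> primes with error \<open>1 / (k + 1)\<close>.\<close>

lemma kronecker_torus:
  assumes \<omega>: "\<omega> \<in> space torus_haar"
  obtains t :: "nat \<Rightarrow> real" where "\<And>j. (\<lambda>k. flow (t k) (\<lambda>_. 1) j) \<longlonglongrightarrow> \<omega> j"
proof -
  interpret Modules.module "(\<lambda>r. (*) (real_of_int r))"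
    by (simp add: Modules.module.intro distrib_left mult.commute)
  define \<theta> where "\<theta> j = - ln (nth_prime j) / (2 * pi)" for j
  define \<alpha> where "\<alpha> j = Arg2pi (\<omega> j) / (2 * pi)" for j
  have inj: "inj \<theta>"
  proof (rule injI)
    fix i j assume "\<theta> i = \<theta> j"
    then have "ln (real (nth_prime i)) = ln (real (nth_prime j))" by (simp add: \<theta>_def)
    then have "nth_prime i = nth_prime j" by simp
    then show "i = j" using inj_nth_prime by (simp add: inj_eq)
  qed
  have indep: "independent (\<theta> ` {..<n})" for n
  proof
    assume "dependent (\<theta> ` {..<n})"
    then obtain T u v where T: "finite T" "T \<subseteq> \<theta> ` {..<n}" "(\<Sum>v\<in>T. real_of_int (u v) * v) = 0"
       and v: "v \<in> T" "u v \<noteq> 0"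
      unfolding dependent_explicit by blast
    define J where "J = {j. \<theta> j \<in> T}"
    have TJ: "T = \<theta> ` J" using T(2) by (auto simp: J_def)
    define S where "S = nth_prime ` J"
    have J: "finite J" using T(1) inj unfolding TJ by (metis finite_imageD inj_on_subset subset_UNIV)
    define c where "c p = u (- ln (real p) / (2 * pi))" for p
    have "(\<Sum>p\<in>S. c p * ln (real p)) = (\<Sum>j\<in>J. c (nth_prime j) * ln (real (nth_prime j)))"
      unfolding S_def by (rule sum.reindex_cong[OF inj_on_subset[OF inj_nth_prime]]) auto
    also have "\<dots> = (\<Sum>j\<in>J. - 2 * pi * (u (\<theta> j) * \<theta> j))"
      by (intro sum.cong) (auto simp: c_def \<theta>_def)
    also have "\<dots> = - 2 * pi * (\<Sum>j\<in>J. u (\<theta> j) * \<theta> j)"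
      by (simp only: sum_distrib_left)
    also have "(\<Sum>j\<in>J. u (\<theta> j) * \<theta> j) = 0"
      using T(3) unfolding TJ by (subst (asm) sum.reindex[OF inj_on_subset[OF inj]]) auto
    finally have "(\<Sum>p\<in>S. c p * ln (real p)) = 0" by simp
    moreover obtain j where j: "j \<in> J" "v = \<theta> j" using v TJ by auto
    ultimately have "c (nth_prime j) = 0"
      by (intro ln_primes_independent[of S c "nth_prime j"]) (use J in \<open>auto simp: S_def nth_prime_prime\<close>)
    with v j show False by (simp add: c_def \<theta>_def)
  qed
  have "\<exists>t. \<forall>i<k. \<exists>h. \<bar>t * \<theta> i - of_int h - \<alpha> i\<bar> < inverse (real (Suc k))" for k
    using Kronecker_thm_1[OF indep[of k] inj_on_subset[OF inj], of "inverse (real (Suc k))" \<alpha>]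
    by (metis inverse_positive_iff_positive of_nat_0_less_iff subset_UNIV zero_less_Suc)
  then obtain t where t: "\<And>k i. i < k \<Longrightarrow> \<exists>h. \<bar>t k * \<theta> i - of_int h - \<alpha> i\<bar> < inverse (real (Suc k))"
    by metis
  have "(\<lambda>k. flow (t k) (\<lambda>_. 1) j) \<longlonglongrightarrow> \<omega> j" for j
  proof -
    obtain h where h: "\<And>k. j < k \<Longrightarrow> \<bar>t k * \<theta> j - of_int (h k) - \<alpha> j\<bar> < inverse (real (Suc k))"
      using t by metis
    define d where "d k = t k * \<theta> j - of_int (h k) - \<alpha> j" for k
    have "d \<longlonglongrightarrow> 0"
    proof (rule Lim_null_comparison)
      show "\<forall>\<^sub>F k in sequentially. norm (d k) \<le> inverse (real (Suc k))"
        using eventually_gt_at_top[of j] by eventually_elim (use h in \<open>force simp: d_def\<close>)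
    qed (rule LIMSEQ_inverse_real_of_nat)
    then have "(\<lambda>k. cis (2 * pi * d k) * \<omega> j) \<longlonglongrightarrow> cis (2 * pi * 0) * \<omega> j"
      by (intro tendsto_intros)
    moreover have "flow (t k) (\<lambda>_. 1) j = cis (2 * pi * d k) * \<omega> j" for k
    proof -
      have \<omega>j: "\<omega> j = cis (2 * pi * \<alpha> j)"
        using Arg2pi[of "\<omega> j"] \<omega> by (simp add: \<alpha>_def cis_conv_exp is_Arg_def space_torus_haar)
      have "cis (2 * pi * d k) * \<omega> j * cis (2 * pi * of_int (h k)) = cis (2 * pi * (t k * \<theta> j))"
        unfolding \<omega>j cis_mult by (simp add: d_def algebra_simps)
      moreover have "cis (2 * pi * of_int (h k)) = 1"
        by (rule cis_multiple_2pi) simp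
      ultimately show ?thesis by (simp add: flow_def \<theta>_def)
    qed
    ultimately show ?thesis by simp
  qed
  then show ?thesis by (rule that)
qed

lemma char_ext_approx:
  assumes \<omega>: "\<omega> \<in> space torus_haar"
  obtains t :: "nat \<Rightarrow> real" where "\<And>n. (\<lambda>k. char_ext (flow (t k) (\<lambda>_. 1)) n) \<longlonglongrightarrow> char_ext \<omega> n"
proof -
  obtain t :: "nat \<Rightarrow> real" where t: "\<And>j. (\<lambda>k. flow (t k) (\<lambda>_. 1) j) \<longlonglongrightarrow> \<omega> j"
    using kronecker_torus[OF \<omega>] by blast
  have "(\<lambda>k. char_ext (flow (t k) (\<lambda>_. 1)) n) \<longlonglongrightarrow> char_ext \<omega> n" for n
    unfolding char_ext_def by (intro tendsto_intros t)
  then show ?thesis by (rule that)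
qed

section \<open>Uniform convergence of all vertical limit functions\<close>

lemma measurable_char_ext [measurable]: "(\<lambda>\<omega>. char_ext \<omega> n) \<in> borel_measurable torus_haar"
  unfolding char_ext_def by measurable

text \<open>Dirichlet series with \<open>\<sigma>\<^sub>u \<le> 0\<close>. The identities proved for them are between elements of \<open>[0, \<infinity>]\<close>.\<close>

locale unif_dirichlet =
  fixes a :: "nat \<Rightarrow> complex"
  assumes abscissa: "abscissa_unif_conv a \<le> 0"
begin

abbreviation psum :: "nat \<Rightarrow> (nat \<Rightarrow> complex) \<Rightarrow> complex \<Rightarrow> complex" where
  "psum N \<omega> s \<equiv> (\<Sum>n=1..N. dterm (twist a \<omega>) n s)"

abbreviation F :: "(nat \<Rightarrow> complex) \<Rightarrow> complex \<Rightarrow> complex" where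
  "F \<equiv> vertical_limit a"

lemma unif_conv:
  assumes "\<theta> > 0"
  shows "uniformly_convergent_on (right_half_plane \<theta>) (\<lambda>N s. \<Sum>n=1..N. dterm a n s)"
proof -
  have "abscissa_unif_conv a < ereal \<theta>"
    using abscissa assms by (metis ereal_less(2) le_less_trans)
  then obtain \<theta>' where \<theta>': "\<theta>' < \<theta>"
      "uniformly_convergent_on (right_half_plane \<theta>') (\<lambda>N s. \<Sum>n=1..N. dterm a n s)"
    unfolding abscissa_unif_conv_def Inf_less_iff by auto
  then show ?thesis
    by (elim uniformly_convergent_on_subset) (auto simp: right_half_plane_def)
qed

text \<open>A partial sum of \<open>f\<^sub>\<omega>\<close> at \<open>s\<close> is a limit of values at \<open>s + i t\<^sub>k\<close> of the same partial sum of \<open>f\<close>. So any bound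
for differences of partial sums of \<open>f\<close> on a half-plane persists for every \<open>\<omega>\<close>.\<close>

lemma uniformly_Cauchy_torus:
  assumes "\<theta> > 0"
  shows "uniformly_Cauchy_on (space torus_haar \<times> right_half_plane \<theta>) (\<lambda>N (\<omega>, s). psum N \<omega> s)"
proof (rule uniformly_Cauchy_onI)
  fix e :: real assume "e > 0"
  then have "uniformly_Cauchy_on (right_half_plane \<theta>) (\<lambda>N s. \<Sum>n=1..N. dterm a n s)" "e/2 > 0"
    using unif_conv[OF assms] uniformly_convergent_Cauchy by auto
  then obtain M where M: "\<And>s m n. s \<in> right_half_plane \<theta> \<Longrightarrow> m \<ge> M \<Longrightarrow> n \<ge> M
      \<Longrightarrow> dist (\<Sum>n=1..m. dterm a n s) (\<Sum>n=1..n. dterm a n s) < e/2"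
    unfolding uniformly_Cauchy_on_def by meson
  have "dist (psum m \<omega> s) (psum n \<omega> s) < e"
    if \<omega>: "\<omega> \<in> space torus_haar" and s: "s \<in> right_half_plane \<theta>" and mn: "m \<ge> M" "n \<ge> M" for \<omega> s m n
  proof -
    obtain t :: "nat \<Rightarrow> real" where
      t: "\<And>n. (\<lambda>k. char_ext (flow (t k) (\<lambda>_. 1)) n) \<longlonglongrightarrow> char_ext \<omega> n"
      using char_ext_approx[OF \<omega>] by blast
    have lim: "(\<lambda>k. psum N (flow (t k) (\<lambda>_. 1)) s) \<longlonglongrightarrow> psum N \<omega> s" for N
      unfolding dterm_def twist_def by (intro tendsto_intros t)
    have eq: "psum N (flow r (\<lambda>_. 1)) s = (\<Sum>n=1..N. dterm a n (s + \<i> * r))" for N r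
      by (intro sum.cong) (simp_all add: dterm_twist_flow, simp add: dterm_def twist_one)
    have "dist (psum m \<omega> s) (psum n \<omega> s) \<le> e/2"
    proof (rule tendsto_upperbound)
      show "(\<lambda>k. dist (psum m (flow (t k) (\<lambda>_. 1)) s) (psum n (flow (t k) (\<lambda>_. 1)) s))
         \<longlonglongrightarrow> dist (psum m \<omega> s) (psum n \<omega> s)"
        by (intro tendsto_dist lim)
      show "\<forall>\<^sub>F k in sequentially. dist (psum m (flow (t k) (\<lambda>_. 1)) s) (psum n (flow (t k) (\<lambda>_. 1)) s) \<le> e/2"
      proof (rule always_eventually, rule allI)
        fix k
        have "s + \<i> * t k \<in> right_half_plane \<theta>" using s by (simp add: right_half_plane_def)
        then show "dist (psum m (flow (t k) (\<lambda>_. 1)) s) (psum n (flow (t k) (\<lambda>_. 1)) s) \<le> e/2"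
          unfolding eq by (intro less_imp_le M mn)
      qed
    qed simp
    then show ?thesis using \<open>e > 0\<close> by simp
  qed
  then show "\<exists>M. \<forall>x\<in>space torus_haar \<times> right_half_plane \<theta>. \<forall>m\<ge>M. \<forall>n\<ge>M.
     dist (case x of (\<omega>, s) \<Rightarrow> psum m \<omega> s) (case x of (\<omega>, s) \<Rightarrow> psum n \<omega> s) < e"
    by (intro exI[of _ M]) auto
qed

lemma uniform_limit_torus:
  assumes "\<theta> > 0"
  shows "uniform_limit (space torus_haar \<times> right_half_plane \<theta>) (\<lambda>N (\<omega>, s). psum N \<omega> s)
     (\<lambda>(\<omega>, s). F \<omega> s) sequentially"
proof -
  obtain l where l: "uniform_limit (space torus_haar \<times> right_half_plane \<theta>) (\<lambda>N (\<omega>, s). psum N \<omega> s) l sequentially"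
    using Cauchy_uniformly_convergent[OF uniformly_Cauchy_torus[OF assms]]
    unfolding uniformly_convergent_on_def by blast
  have "l (\<omega>, s) = F \<omega> s" if "\<omega> \<in> space torus_haar" "s \<in> right_half_plane \<theta>" for \<omega> s
  proof -
    have "(\<lambda>N. psum N \<omega> s) \<longlonglongrightarrow> l (\<omega>, s)"
      using tendsto_uniform_limitI[OF l, of "(\<omega>, s)"] that by simp
    moreover have "psum N \<omega> s = (\<Sum>n<N. dterm (twist a \<omega>) (Suc n) s)" for N
      by (simp add: sum.atLeast1_atMost_eq)
    ultimately have "(\<lambda>n. dterm (twist a \<omega>) (Suc n) s) sums l (\<omega>, s)"
      by (simp add: sums_def)
    then show ?thesis unfolding dseries_def by (simp add: sums_unique)
  qed
  then have "uniform_limit (space torus_haar \<times> right_half_plane \<theta>) (\<lambda>N (\<omega>, s). psum N \<omega> s) l sequentially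
      \<longleftrightarrow> ?thesis"
    by (intro uniform_limit_cong') auto
  with l show ?thesis by blast
qed

lemma uniform_approx:
  assumes "\<theta> > 0" "e > 0"
  obtains N where "\<And>\<omega> s n. \<omega> \<in> space torus_haar \<Longrightarrow> Re s > \<theta> \<Longrightarrow> n \<ge> N \<Longrightarrow> cmod (psum n \<omega> s - F \<omega> s) < e"
proof -
  obtain N where "\<And>x n. x \<in> space torus_haar \<times> right_half_plane \<theta> \<Longrightarrow> n \<ge> N \<Longrightarrow>
      dist (case x of (\<omega>, s) \<Rightarrow> psum n \<omega> s) (case x of (\<omega>, s) \<Rightarrow> F \<omega> s) < e"
    using uniform_limit_torus[OF assms(1)] assms(2) unfolding uniform_limit_sequentially_iff by meson
  from this[of "(_, _)"] show ?thesis
    by (intro that) (auto simp: dist_norm right_half_plane_def)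
qed

lemma dterm_bound:
  assumes "\<omega> \<in> space torus_haar" "n > 0"
  shows "cmod (dterm (twist a \<omega>) n s) = cmod (a n) * exp (- (Re s * ln (real n)))"
  using assms by (simp add: dterm_def twist_def norm_mult of_nat_powr_neg)

lemma F_bounded:
  assumes "\<theta> > 0"
  obtains K where "K > 0" "\<And>\<omega> s. \<omega> \<in> space torus_haar \<Longrightarrow> Re s > \<theta> \<Longrightarrow> cmod (F \<omega> s) < K"
proof -
  obtain N where N: "\<And>\<omega> s n. \<omega> \<in> space torus_haar \<Longrightarrow> Re s > \<theta> \<Longrightarrow> n \<ge> N \<Longrightarrow> cmod (psum n \<omega> s - F \<omega> s) < 1"
    using uniform_approx[OF assms, of 1] by auto
  define K where "K = (\<Sum>n=1..N. cmod (a n)) + 1"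
  have "cmod (F \<omega> s) < K" if "\<omega> \<in> space torus_haar" "Re s > \<theta>" for \<omega> s
  proof -
    have "cmod (psum N \<omega> s) \<le> (\<Sum>n=1..N. cmod (a n))"
    proof (rule sum_norm_le)
      fix n assume "n \<in> {1..N}"
      then have n: "n > 0" by auto
      have "exp (- (Re s * ln (real n))) \<le> 1"
        using n that assms by simp
      then show "cmod (dterm (twist a \<omega>) n s) \<le> cmod (a n)"
        unfolding dterm_bound[OF that(1) n] by (simp add: mult_left_le)
    qed
    moreover have "cmod (psum N \<omega> s - F \<omega> s) < 1" using N[OF that] by simp
    moreover have "cmod (F \<omega> s) \<le> cmod (psum N \<omega> s) + cmod (psum N \<omega> s - F \<omega> s)"
      by (metis norm_minus_commute norm_triangle_sub)
    ultimately show ?thesis unfolding K_def by linarith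
  qed
  moreover have "K > 0" unfolding K_def by (smt (verit) norm_ge_zero sum_nonneg)
  ultimately show ?thesis using that by blast
qed

text \<open>Uniform convergence leaves finitely many terms, and each term with \<open>n \<ge> 2\<close> decays like \<open>2\<^sup>-\<^sup>\<sigma>\<close>.\<close>

lemma F_at_infinity:
  assumes "e > 0"
  obtains R where "R > 0" "\<And>\<omega> s. \<omega> \<in> space torus_haar \<Longrightarrow> Re s > R \<Longrightarrow> cmod (F \<omega> s - a 1) < e"
proof -
  obtain N0 where N0: "\<And>\<omega> s n. \<omega> \<in> space torus_haar \<Longrightarrow> Re s > 1 \<Longrightarrow> n \<ge> N0 \<Longrightarrow> cmod (psum n \<omega> s - F \<omega> s) < e/2"
    using uniform_approx[of 1 "e/2"] assms by auto
  define N where "N = Suc N0"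
  define A where "A = (\<Sum>n=2..N. cmod (a n))"
  have "((\<lambda>r::real. A * exp (- (r * ln 2))) \<longlongrightarrow> 0) at_top"
    by (intro tendsto_mult_right_zero filterlim_compose[OF exp_at_bot] filterlim_uminus_at_bot_at_top
      filterlim_at_top_mult_tendsto_pos[of _ "ln 2"] filterlim_compose[OF filterlim_uminus_at_bot_at_top]
      filterlim_at_top_mult_tendsto_pos tendsto_const filterlim_ident) auto
  then have "\<forall>\<^sub>F r in at_top. A * exp (- (r * ln 2)) < e/2"
    using assms by (intro order_tendstoD(2)) auto
  then obtain R0 where R0: "\<And>r. r \<ge> R0 \<Longrightarrow> A * exp (- (r * ln 2)) < e/2"
    by (auto simp: eventually_at_top_linorder)
  have "cmod (F \<omega> s - a 1) < e" if \<omega>: "\<omega> \<in> space torus_haar" and s: "Re s > max 1 R0" for \<omega> s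
  proof -
    have "psum N \<omega> s - a 1 = (\<Sum>n=2..N. dterm (twist a \<omega>) n s)"
      by (subst sum.atLeast_Suc_atMost) (auto simp: N_def dterm_def twist_def numeral_2_eq_2)
    also have "cmod \<dots> \<le> (\<Sum>n=2..N. cmod (a n) * exp (- (Re s * ln 2)))"
    proof (rule sum_norm_le)
      fix n assume n: "n \<in> {2..N}"
      then have "ln 2 \<le> ln (real n)" by simp
      then have "exp (- (Re s * ln (real n))) \<le> exp (- (Re s * ln 2))"
        using s by (simp add: mult_left_mono)
      then show "cmod (dterm (twist a \<omega>) n s) \<le> cmod (a n) * exp (- (Re s * ln 2))"
        using n by (subst dterm_bound[OF \<omega>]) (auto intro: mult_left_mono)
    qed
    also have "\<dots> = A * exp (- (Re s * ln 2))" by (simp add: A_def sum_distrib_right)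
    also have "\<dots> < e/2" using s by (intro R0) simp
    finally have "cmod (psum N \<omega> s - a 1) < e/2" .
    moreover have "cmod (psum N \<omega> s - F \<omega> s) < e/2" using N0[OF \<omega>, of s N] s by (simp add: N_def)
    moreover have "cmod (F \<omega> s - a 1) \<le> cmod (psum N \<omega> s - F \<omega> s) + cmod (psum N \<omega> s - a 1)"
      by (metis dist_commute dist_norm dist_triangle)
    ultimately show ?thesis by linarith
  qed
  then show ?thesis using that[of "max 1 R0"] by auto
qed

lemma F_holomorphic:
  assumes "\<omega> \<in> space torus_haar"
  shows "F \<omega> holomorphic_on right_half_plane 0"
proof (rule holomorphic_uniform_sequence)
  show "open (right_half_plane 0)"
    unfolding right_half_plane_def by (rule open_halfspace_Re_gt)
  show "(\<lambda>s. psum n \<omega> s) holomorphic_on right_half_plane 0" for n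
    unfolding dterm_def by (intro holomorphic_intros) auto
  fix x assume x: "x \<in> right_half_plane 0"
  \<comment> \<open>The closed disc of radius \<open>d\<close> about \<open>x\<close> lies in \<open>Re z \<ge> d\<close>, hence in \<open>Re z > d / 2\<close>.\<close>
  define d where "d = Re x / 2"
  have d: "d > 0" using x by (simp add: d_def right_half_plane_def)
  have sub: "Re z > d / 2" if "z \<in> cball x d" for z
  proof -
    have "Re x - Re z \<le> d"
      using that abs_Re_le_cmod[of "x - z"] by (simp add: dist_norm)
    then show ?thesis using d by (simp add: d_def)
  qed
  have "uniform_limit (cball x d) (\<lambda>n. psum n \<omega>) (F \<omega>) sequentially"
  proof (rule uniform_limitI)
    fix e :: real assume "e > 0"
    then obtain N where "\<And>\<omega> s n. \<omega> \<in> space torus_haar \<Longrightarrow> Re s > d / 2 \<Longrightarrow> n \<ge> N \<Longrightarrow> cmod (psum n \<omega> s - F \<omega> s) < e"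
      using uniform_approx[of "d / 2" e] d by auto
    then show "\<forall>\<^sub>F n in sequentially. \<forall>s\<in>cball x d. dist (psum n \<omega> s) (F \<omega> s) < e"
      unfolding eventually_sequentially dist_norm using sub assms by blast
  qed
  moreover have "cball x d \<subseteq> right_half_plane 0"
    using sub d by (force simp: right_half_plane_def)
  ultimately show "\<exists>d>0. cball x d \<subseteq> right_half_plane 0 \<and> uniform_limit (cball x d) (\<lambda>n. psum n \<omega>) (F \<omega>) sequentially"
    using d by blast
qed

lemma F_deriv_bound:
  assumes \<omega>: "\<omega> \<in> space torus_haar" and s: "Re s > \<theta>" and r: "0 < r" "r \<le> \<theta>" and n: "n > 0"
    and B: "\<And>w. Re w > \<theta> - r \<Longrightarrow> cmod (F \<omega> w - y) < B"
  shows "cmod ((deriv ^^ n) (F \<omega>) s) \<le> fact n * B / r ^ n"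
proof -
  have sub: "Re z > \<theta> - r" if "z \<in> cball s r" for z
    using that s abs_Re_le_cmod[of "s - z"] by (simp add: dist_norm)
  then have sub': "cball s r \<subseteq> right_half_plane 0"
    using r by (force simp: right_half_plane_def)
  have hol: "F \<omega> holomorphic_on cball s r"
    by (rule holomorphic_on_subset[OF F_holomorphic[OF \<omega>] sub'])
  show ?thesis
  proof (rule Cauchy_higher_deriv_bound)
    show "F \<omega> holomorphic_on ball s r" using hol by (rule holomorphic_on_subset) auto
    show "continuous_on (cball s r) (F \<omega>)" using hol by (rule holomorphic_on_imp_continuous_on)
    show "F \<omega> w \<in> ball y B" if "w \<in> ball s r" for w
      using B[OF sub, of w] that by (simp add: dist_norm norm_minus_commute)
  qed (use r n in auto)
qed

lemma F_derivs_bounded: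
  assumes "\<theta> > 0" "n > 0"
  obtains K where "K > 0" "\<And>\<omega> s. \<omega> \<in> space torus_haar \<Longrightarrow> Re s > \<theta> \<Longrightarrow> cmod ((deriv ^^ n) (F \<omega>) s) \<le> K"
proof -
  obtain B where B: "B > 0" "\<And>\<omega> s. \<omega> \<in> space torus_haar \<Longrightarrow> Re s > \<theta>/2 \<Longrightarrow> cmod (F \<omega> s) < B"
    using F_bounded[of "\<theta>/2"] assms by auto
  show ?thesis
    using F_deriv_bound[of _ \<theta> _ "\<theta>/2" n 0 B] B assms
    by (intro that[of "fact n * B / (\<theta>/2) ^ n"]) auto
qed

text \<open>Cauchy's estimate for \<open>f\<^sub>\<omega> - a\<^sub>1\<close> on a disc of radius comparable to \<open>Re s\<close>: the factor \<open>Re s\<close> is absorbed by the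
radius, and \<open>f\<^sub>\<omega> - a\<^sub>1\<close> itself becomes small.\<close>

lemma F_deriv_decay:
  assumes "e > 0"
  obtains R where "R > 0"
    "\<And>\<omega> s. \<omega> \<in> space torus_haar \<Longrightarrow> Re s > R \<Longrightarrow> Re s * cmod (deriv (F \<omega>) s) \<le> e"
proof -
  obtain R where R: "R > 0" "\<And>\<omega> s. \<omega> \<in> space torus_haar \<Longrightarrow> Re s > R \<Longrightarrow> cmod (F \<omega> s - a 1) < e/4"
    using F_at_infinity[of "e/4"] assms by auto
  have "Re s * cmod (deriv (F \<omega>) s) \<le> e" if \<omega>: "\<omega> \<in> space torus_haar" and s: "Re s > 4 * R" for \<omega> s
  proof -
    define x where "x = Re s"
    have x: "x > 4 * R" using s by (simp add: x_def)
    \<comment> \<open>Discs of radius \<open>x / 4\<close> about points with \<open>Re s > x / 2\<close> lie to the right of \<open>x / 4 > R\<close>.\<close>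
    have "cmod ((deriv ^^ 1) (F \<omega>) s) \<le> fact 1 * (e/4) / (x/4) ^ 1"
      using x R s by (intro F_deriv_bound[OF \<omega>, of "x/2" _ _ _ "a 1"] R \<omega>) (auto simp: x_def)
    then show ?thesis using x R by (simp add: x_def field_simps)
  qed
  then show ?thesis using R by (intro that[of "4 * R"]) auto
qed

text \<open>The first two derivatives of \<open>f\<^sub>\<omega>\<close>, extended by \<open>0\<close> to the left half-plane so that they are jointly
measurable in \<open>(\<omega>, s)\<close> everywhere.\<close>

definition F1 :: "(nat \<Rightarrow> complex) \<Rightarrow> complex \<Rightarrow> complex" where
  "F1 \<omega> s = (if Re s > 0 then deriv (F \<omega>) s else 0)"

definition F2 :: "(nat \<Rightarrow> complex) \<Rightarrow> complex \<Rightarrow> complex" where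
  "F2 \<omega> s = (if Re s > 0 then deriv (deriv (F \<omega>)) s else 0)"

lemma F_has_derivative:
  assumes "\<omega> \<in> space torus_haar" "Re s > 0"
  shows "(F \<omega> has_field_derivative F1 \<omega> s) (at s)"
    and "(F1 \<omega> has_field_derivative F2 \<omega> s) (at s)"
proof -
  have o: "open (right_half_plane 0)"
    unfolding right_half_plane_def by (rule open_halfspace_Re_gt)
  note hol = F_holomorphic[OF assms(1)]
  show "(F \<omega> has_field_derivative F1 \<omega> s) (at s)"
    using holomorphic_derivI[OF hol o, of s] assms by (simp add: F1_def right_half_plane_def)
  have "(deriv (F \<omega>) has_field_derivative F2 \<omega> s) (at s)"
    using holomorphic_derivI[OF holomorphic_deriv[OF hol o] o, of s] assms
    by (simp add: F2_def right_half_plane_def)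
  then show "(F1 \<omega> has_field_derivative F2 \<omega> s) (at s)"
    by (rule has_field_derivative_transform_within_open[OF _ o])
       (use assms in \<open>auto simp: F1_def right_half_plane_def\<close>)
qed

lemma measurable_F [measurable (raw)]:
  assumes w[measurable]: "w \<in> M \<rightarrow>\<^sub>M torus_haar" and s[measurable]: "s \<in> borel_measurable M"
  shows "(\<lambda>x. F (w x) (s x)) \<in> borel_measurable M"
proof -
  have eq: "dterm (twist a \<omega>) (Suc n) z = a (Suc n) * char_ext \<omega> (Suc n) * exp (- (z * of_real (ln (real (Suc n)))))" for \<omega> n z
    by (simp add: dterm_def twist_def of_nat_powr_neg del: of_nat_Suc)
  have [measurable]: "(\<lambda>x. char_ext (w x) n) \<in> borel_measurable M" for n
    by (rule measurable_compose[OF w measurable_char_ext])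
  show ?thesis
    unfolding dseries_def eq by measurable
qed

text \<open>This exhibits a derivative as a pointwise limit of a sequence of difference quotients, which is how
joint measurability passes from \<open>f\<^sub>\<omega>\<close> to its derivatives.\<close>

lemma difference_quotient_LIMSEQ:
  assumes "(f has_field_derivative d) (at (s::complex))"
  shows "(\<lambda>k. (f (s + of_real (inverse (real (Suc k)))) - f s) * of_nat (Suc k)) \<longlonglongrightarrow> d"
proof -
  have "((\<lambda>h. (f (s + h) - f s) / h) \<longlongrightarrow> d) (at 0)"
    using assms by (simp add: DERIV_def)
  moreover have "filterlim (\<lambda>k. complex_of_real (inverse (real (Suc k)))) (at 0) sequentially"
    unfolding filterlim_at
    using tendsto_of_real[OF LIMSEQ_inverse_real_of_nat] by (auto simp del: of_nat_Suc of_real_inverse)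
  ultimately have "(\<lambda>k. (f (s + of_real (inverse (real (Suc k)))) - f s) / of_real (inverse (real (Suc k)))) \<longlonglongrightarrow> d"
    by (rule filterlim_compose)
  then show ?thesis
    by (simp add: field_simps del: of_nat_Suc)
qed

lemma measurable_F1 [measurable (raw)]:
  assumes w[measurable]: "w \<in> M \<rightarrow>\<^sub>M torus_haar" and s[measurable]: "s \<in> borel_measurable M"
  shows "(\<lambda>x. F1 (w x) (s x)) \<in> borel_measurable M"
proof (rule borel_measurable_LIMSEQ_metric)
  let ?q = "\<lambda>k x. if Re (s x) > 0 then
      (F (w x) (s x + of_real (inverse (real (Suc k)))) - F (w x) (s x)) * of_nat (Suc k) else 0"
  show "?q k \<in> borel_measurable M" for k by measurable
  show "(\<lambda>k. ?q k x) \<longlonglongrightarrow> F1 (w x) (s x)" if "x \<in> space M" for x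
  proof (cases "Re (s x) > 0")
    case True
    with difference_quotient_LIMSEQ[OF F_has_derivative(1)[OF measurable_space[OF w that] True]]
    show ?thesis by simp
  qed (simp add: F1_def)
qed

lemma measurable_F2 [measurable (raw)]:
  assumes w[measurable]: "w \<in> M \<rightarrow>\<^sub>M torus_haar" and s[measurable]: "s \<in> borel_measurable M"
  shows "(\<lambda>x. F2 (w x) (s x)) \<in> borel_measurable M"
proof (rule borel_measurable_LIMSEQ_metric)
  let ?q = "\<lambda>k x. if Re (s x) > 0 then
      (F1 (w x) (s x + of_real (inverse (real (Suc k)))) - F1 (w x) (s x)) * of_nat (Suc k) else 0"
  show "?q k \<in> borel_measurable M" for k by measurable
  show "(\<lambda>k. ?q k x) \<longlonglongrightarrow> F2 (w x) (s x)" if "x \<in> space M" for x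
  proof (cases "Re (s x) > 0")
    case True
    with difference_quotient_LIMSEQ[OF F_has_derivative(2)[OF measurable_space[OF w that] True]]
    show ?thesis by simp
  qed (simp add: F2_def)
qed

lemma F_flow: "F (flow t \<omega>) s = F \<omega> (s + \<i> * t)"
  by (rule vertical_limit_flow)

lemma F1_flow:
  assumes "\<omega> \<in> space torus_haar"
  shows "F1 (flow t \<omega>) s = F1 \<omega> (s + \<i> * t)"
proof (cases "Re s > 0")
  case True
  have "((\<lambda>z. F \<omega> (z + \<i> * t)) has_field_derivative F1 \<omega> (s + \<i> * t)) (at s)"
    using F_has_derivative(1)[OF assms, of "s + \<i> * t"] True by (simp add: DERIV_shift)
  moreover have "F (flow t \<omega>) = (\<lambda>z. F \<omega> (z + \<i> * t))" by (simp add: F_flow fun_eq_iff)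
  ultimately have "((F (flow t \<omega>)) has_field_derivative F1 \<omega> (s + \<i> * t)) (at s)" by simp
  then show ?thesis
    using DERIV_unique F_has_derivative(1)[OF flow_space[OF assms] True] by blast
qed (simp add: F1_def)

lemma F2_flow:
  assumes "\<omega> \<in> space torus_haar"
  shows "F2 (flow t \<omega>) s = F2 \<omega> (s + \<i> * t)"
proof (cases "Re s > 0")
  case True
  have "((\<lambda>z. F1 \<omega> (z + \<i> * t)) has_field_derivative F2 \<omega> (s + \<i> * t)) (at s)"
    using F_has_derivative(2)[OF assms, of "s + \<i> * t"] True by (simp add: DERIV_shift)
  moreover have "F1 (flow t \<omega>) = (\<lambda>z. F1 \<omega> (z + \<i> * t))" using assms by (simp add: F1_flow fun_eq_iff)
  ultimately have "((F1 (flow t \<omega>)) has_field_derivative F2 \<omega> (s + \<i> * t)) (at s)" by simp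
  then show ?thesis
    using DERIV_unique F_has_derivative(2)[OF flow_space[OF assms] True] by blast
qed (simp add: F2_def)

end

section \<open>Vertical means are integrals over the torus\<close>

text \<open>The trigonometric polynomials on the torus. Every monomial is of the form \<open>\<omega>(m) / \<omega>(n)\<close>, with \<open>\<omega>\<close> read as a
completely multiplicative function on the integers.\<close>

inductive_set trig_poly :: "((nat \<Rightarrow> complex) \<Rightarrow> complex) set" where
  monomial: "m > 0 \<Longrightarrow> n > 0 \<Longrightarrow> (\<lambda>\<omega>. c * (char_ext \<omega> m * cnj (char_ext \<omega> n))) \<in> trig_poly"
| add: "g \<in> trig_poly \<Longrightarrow> h \<in> trig_poly \<Longrightarrow> (\<lambda>\<omega>. g \<omega> + h \<omega>) \<in> trig_poly"

lemma trig_poly_mult: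
  assumes "g \<in> trig_poly" "h \<in> trig_poly"
  shows "(\<lambda>\<omega>. g \<omega> * h \<omega>) \<in> trig_poly"
  using assms(1)
proof induction
  case (monomial m n c)
  note mn = monomial
  show ?case using assms(2)
  proof induction
    case (monomial m' n' c')
    have "(\<lambda>\<omega>. (c * c') * (char_ext \<omega> (m * m') * cnj (char_ext \<omega> (n * n')))) \<in> trig_poly"
      using mn monomial by (intro trig_poly.monomial) auto
    then show ?case using mn monomial by (simp add: char_ext_mult mult_ac)
  next
    case (add g h)
    then show ?case unfolding distrib_left by (intro trig_poly.add)
  qed
next
  case (add g h)
  then show ?case unfolding distrib_right by (intro trig_poly.add)
qed

lemma trig_poly_cnj: "g \<in> trig_poly \<Longrightarrow> (\<lambda>\<omega>. cnj (g \<omega>)) \<in> trig_poly"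
proof (induction rule: trig_poly.induct)
  case (monomial m n c)
  then show ?case using trig_poly.monomial[of n m "cnj c"] by (simp add: mult_ac)
next
  case (add g h)
  then show ?case by (simp add: trig_poly.add)
qed

lemma trig_poly_const: "(\<lambda>_. c) \<in> trig_poly"
  using trig_poly.monomial[of 1 1 c] by simp

lemma trig_poly_sum: "(\<And>n. n \<in> A \<Longrightarrow> g n \<in> trig_poly) \<Longrightarrow> (\<lambda>\<omega>. \<Sum>n\<in>A. g n \<omega>) \<in> trig_poly"
  by (induction A rule: infinite_finite_induct) (auto intro: trig_poly_const trig_poly.add)

lemma measurable_trig_poly: "g \<in> trig_poly \<Longrightarrow> g \<in> borel_measurable torus_haar"
proof (induction rule: trig_poly.induct)
  case (monomial m n c)
  have [measurable]: "cnj \<in> borel_measurable borel"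
    by (intro borel_measurable_continuous_onI continuous_intros)
  show ?case by measurable
next
  case (add g h)
  then show ?case by measurable
qed

lemma trig_poly_bounded: "g \<in> trig_poly \<Longrightarrow> \<exists>K. \<forall>\<omega>\<in>space torus_haar. cmod (g \<omega>) \<le> K"
proof (induction rule: trig_poly.induct)
  case (monomial m n c)
  show ?case by (intro exI[of _ "cmod c"]) (simp add: norm_mult)
next
  case (add g h)
  then show ?case by (meson add_mono norm_triangle_le)
qed

lemma char_ext_flow_one: "n > 0 \<Longrightarrow> char_ext (flow t (\<lambda>_. 1)) n = cis (- t * ln n)"
  by (simp add: char_ext_flow) (simp add: char_ext_def)

lemma continuous_trig_poly_flow: "g \<in> trig_poly \<Longrightarrow> continuous_on A (\<lambda>t. g (flow t (\<lambda>_. 1)))"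
  by (induction rule: trig_poly.induct) (auto simp: char_ext_flow_one intro!: continuous_intros)

lemma set_integral_cis:
  assumes "l \<noteq> 0" "T \<ge> 0"
  shows "cmod (LBINT t:{-T..T}. c * cis (t * l)) \<le> 2 * cmod c / \<bar>l\<bar>"
proof -
  define G where "G t = c * cis (t * l) / (\<i> * l)" for t
  have "(LBINT t:{-T..T}. c * cis (t * l)) = G T - G (- T)"
    unfolding set_lebesgue_integral_def
  proof (rule integral_FTC_atLeastAtMost)
    show "(G has_vector_derivative c * cis (x * l)) (at x within {-T..T})" for x
      unfolding G_def using assms
      by (auto intro!: derivative_eq_intros simp: has_vector_derivative_def fun_eq_iff scaleR_conv_of_real field_simps)
  qed (use assms in \<open>auto intro!: continuous_intros\<close>)
  also have "cmod \<dots> \<le> cmod (G T) + cmod (G (- T))" by (rule norm_triangle_ineq4)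
  also have "\<dots> = 2 * cmod c / \<bar>l\<bar>" by (simp add: G_def norm_mult norm_divide)
  finally show ?thesis .
qed

definition flow_mean :: "((nat \<Rightarrow> complex) \<Rightarrow> complex) \<Rightarrow> real \<Rightarrow> complex" where
  "flow_mean h T = inverse (2 * T) *\<^sub>R (LBINT t:{-T..T}. h (flow t (\<lambda>_. 1)))"

text \<open>Along the flow the monomial \<open>\<omega>(m) / \<omega>(n)\<close> oscillates with frequency \<open>ln n - ln m\<close>. If \<open>m \<noteq> n\<close>, its mean
along the orbit vanishes by cancellation, and its torus integral because the flow at time \<open>pi / (ln n - ln m)\<close>
changes its sign.\<close>

lemma tendsto_flow_mean_trig_poly:
  "g \<in> trig_poly \<Longrightarrow> (flow_mean g \<longlongrightarrow> (\<integral>\<omega>. g \<omega> \<partial>torus_haar)) at_top"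
proof (induction rule: trig_poly.induct)
  case (monomial m n c)
  let ?h = "\<lambda>\<omega>. c * (char_ext \<omega> m * cnj (char_ext \<omega> n))"
  define l where "l = ln (real n) - ln (real m)"
  have flow: "?h (flow t \<omega>) = cis (t * l) * ?h \<omega>" for t \<omega>
  proof -
    have "cis (t * l) = cis (- t * ln m) * cis (t * ln n)"
      by (simp add: cis_mult l_def algebra_simps)
    then show ?thesis using monomial by (simp add: char_ext_flow cis_cnj mult_ac)
  qed
  have flow1: "?h (flow t (\<lambda>_. 1)) = c * cis (t * l)" for t
    using flow[of t "\<lambda>_. 1"] by (simp add: char_ext_def)
  show ?case
  proof (cases "m = n")
    case True
    have "(\<integral>\<omega>. ?h \<omega> \<partial>torus_haar) = (\<integral>\<omega>. c \<partial>torus_haar)"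
      by (intro Bochner_Integration.integral_cong)
         (auto simp: True complex_norm_square[symmetric])
    then have int: "(\<integral>\<omega>. ?h \<omega> \<partial>torus_haar) = c" by (simp add: torus.prob_space)
    have "\<forall>\<^sub>F T in at_top. flow_mean ?h T = c"
      using eventually_gt_at_top[of 0]
    proof eventually_elim
      case (elim T)
      then show ?case
        unfolding flow_mean_def flow1 set_lebesgue_integral_def using True by (simp add: l_def)
    qed
    then show ?thesis unfolding int by (rule tendsto_eventually)
  next
    case False
    then have l: "l \<noteq> 0" using monomial by (simp add: l_def)
    have "(\<integral>\<omega>. ?h \<omega> \<partial>torus_haar) = (\<integral>\<omega>. ?h (flow (pi / l) \<omega>) \<partial>torus_haar)"
      by (rule integral_flow[symmetric]) (intro measurable_trig_poly trig_poly.monomial monomial)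
    also have "\<dots> = - (\<integral>\<omega>. ?h \<omega> \<partial>torus_haar)"
      unfolding flow using l by simp
    finally have int: "(\<integral>\<omega>. ?h \<omega> \<partial>torus_haar) = 0" by simp
    have "(flow_mean ?h \<longlongrightarrow> 0) at_top"
    proof (rule Lim_null_comparison)
      show "\<forall>\<^sub>F T in at_top. norm (flow_mean ?h T) \<le> (cmod c / \<bar>l\<bar>) * inverse T"
        using eventually_gt_at_top[of 0]
      proof eventually_elim
        case (elim T)
        have "norm (flow_mean ?h T) = inverse (2 * T) * cmod (LBINT t:{-T..T}. c * cis (t * l))"
          unfolding flow_mean_def flow1 using elim by simp
        also have "\<dots> \<le> inverse (2 * T) * (2 * cmod c / \<bar>l\<bar>)"
          using elim l by (intro mult_left_mono set_integral_cis) auto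
        finally show ?case using elim by (simp add: field_simps)
      qed
      show "((\<lambda>T::real. (cmod c / \<bar>l\<bar>) * inverse T) \<longlongrightarrow> 0) at_top"
        by (intro tendsto_mult_right_zero tendsto_inverse_0_at_top filterlim_ident)
    qed
    then show ?thesis unfolding int .
  qed
next
  case (add g h)
  have "flow_mean (\<lambda>\<omega>. g \<omega> + h \<omega>) = (\<lambda>T. flow_mean g T + flow_mean h T)"
  proof
    fix T
    have "set_integrable lborel {-T..T} (\<lambda>t. g (flow t (\<lambda>_. 1)))"
         "set_integrable lborel {-T..T} (\<lambda>t. h (flow t (\<lambda>_. 1)))"
      using add by (auto intro!: borel_integrable_atLeastAtMost' continuous_trig_poly_flow)
    then show "flow_mean (\<lambda>\<omega>. g \<omega> + h \<omega>) T = flow_mean g T + flow_mean h T"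
      unfolding flow_mean_def by (simp add: set_integral_add scaleR_add_right)
  qed
  moreover have "(\<integral>\<omega>. g \<omega> + h \<omega> \<partial>torus_haar) = (\<integral>\<omega>. g \<omega> \<partial>torus_haar) + (\<integral>\<omega>. h \<omega> \<partial>torus_haar)"
  proof (rule Bochner_Integration.integral_add)
    have "integrable torus_haar f" if f: "f \<in> trig_poly" for f
    proof -
      obtain K where "\<forall>\<omega>\<in>space torus_haar. cmod (f \<omega>) \<le> K" using trig_poly_bounded[OF f] by blast
      then show ?thesis
        by (intro torus.integrable_const_bound[of _ K] measurable_trig_poly f AE_I2) auto
    qed
    then show "integrable torus_haar g" "integrable torus_haar h" using add by auto
  qed
  ultimately show ?case using add.IH by (simp add: tendsto_add)
qed

text \<open>Uniform limits of trigonometric polynomials.\<close>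

definition trig_approximable :: "((nat \<Rightarrow> complex) \<Rightarrow> complex) \<Rightarrow> bool" where
  "trig_approximable h \<longleftrightarrow>
     (\<forall>e>0. \<exists>g\<in>trig_poly. \<forall>\<omega>\<in>space torus_haar. cmod (h \<omega> - g \<omega>) < e)"

lemma trig_approximableD:
  assumes "trig_approximable h" "e > 0"
  shows "\<exists>g\<in>trig_poly. \<forall>\<omega>\<in>space torus_haar. cmod (h \<omega> - g \<omega>) < e"
  using assms unfolding trig_approximable_def by blast

lemma trig_approximable_limit:
  assumes "\<And>e. e > 0 \<Longrightarrow> \<exists>g. trig_approximable g \<and> (\<forall>\<omega>\<in>space torus_haar. cmod (h \<omega> - g \<omega>) < e)"
  shows "trig_approximable h"
  unfolding trig_approximable_def
proof (intro allI impI)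
  fix e :: real assume "e > 0"
  then obtain f where f: "trig_approximable f" "\<And>\<omega>. \<omega>\<in>space torus_haar \<Longrightarrow> cmod (h \<omega> - f \<omega>) < e/2"
    using assms[of "e/2"] by auto
  obtain g where g: "g \<in> trig_poly" "\<And>\<omega>. \<omega> \<in> space torus_haar \<Longrightarrow> cmod (f \<omega> - g \<omega>) < e/2"
    using trig_approximableD[OF f(1), of "e/2"] \<open>e > 0\<close> by auto
  have "cmod (h \<omega> - g \<omega>) < e" if "\<omega> \<in> space torus_haar" for \<omega>
    using f(2)[OF that] g(2)[OF that] norm_triangle_ineq[of "h \<omega> - f \<omega>" "f \<omega> - g \<omega>"] by simp
  then show "\<exists>g\<in>trig_poly. \<forall>\<omega>\<in>space torus_haar. cmod (h \<omega> - g \<omega>) < e" using g by blast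
qed

lemma trig_approximable_trig_poly: "g \<in> trig_poly \<Longrightarrow> trig_approximable g"
  unfolding trig_approximable_def by (metis diff_self norm_zero)

lemma trig_approximable_add:
  assumes "trig_approximable f" "trig_approximable g"
  shows "trig_approximable (\<lambda>\<omega>. f \<omega> + g \<omega>)"
  unfolding trig_approximable_def
proof (intro allI impI)
  fix e :: real assume e: "e > 0"
  obtain f' where f': "f' \<in> trig_poly" "\<And>\<omega>. \<omega> \<in> space torus_haar \<Longrightarrow> cmod (f \<omega> - f' \<omega>) < e/2"
    using trig_approximableD[OF assms(1), of "e/2"] e by auto
  obtain g' where g': "g' \<in> trig_poly" "\<And>\<omega>. \<omega> \<in> space torus_haar \<Longrightarrow> cmod (g \<omega> - g' \<omega>) < e/2"
    using trig_approximableD[OF assms(2), of "e/2"] e by auto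
  have "cmod (f \<omega> + g \<omega> - (f' \<omega> + g' \<omega>)) < e" if "\<omega> \<in> space torus_haar" for \<omega>
    using f'(2)[OF that] g'(2)[OF that] norm_diff_triangle_ineq[of "f \<omega>" "g \<omega>" "f' \<omega>" "g' \<omega>"]
    by linarith
  then show "\<exists>h\<in>trig_poly. \<forall>\<omega>\<in>space torus_haar. cmod (f \<omega> + g \<omega> - h \<omega>) < e"
    by (intro bexI[OF _ trig_poly.add[OF f'(1) g'(1)]] ballI)
qed

lemma trig_approximable_bounded:
  assumes "trig_approximable f"
  obtains K where "K > 0" "\<And>\<omega>. \<omega> \<in> space torus_haar \<Longrightarrow> cmod (f \<omega>) \<le> K"
proof -
  obtain g where g: "g \<in> trig_poly" "\<And>\<omega>. \<omega> \<in> space torus_haar \<Longrightarrow> cmod (f \<omega> - g \<omega>) < 1"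
    using trig_approximableD[OF assms, of 1] by auto
  obtain K where K: "\<And>\<omega>. \<omega>\<in>space torus_haar \<Longrightarrow> cmod (g \<omega>) \<le> K"
    using trig_poly_bounded[OF g(1)] by blast
  have "cmod (f \<omega>) \<le> \<bar>K\<bar> + 1" if "\<omega> \<in> space torus_haar" for \<omega>
    using g(2)[OF that] K[OF that] norm_triangle_sub[of "f \<omega>" "g \<omega>"] by linarith
  then show ?thesis using that[of "\<bar>K\<bar> + 1"] by auto
qed

lemma trig_approximable_mult:
  assumes "trig_approximable f" "trig_approximable g"
  shows "trig_approximable (\<lambda>\<omega>. f \<omega> * g \<omega>)"
  unfolding trig_approximable_def
proof (intro allI impI)
  fix e :: real assume e: "e > 0"
  obtain K where K: "K > 0" "\<And>\<omega>. \<omega> \<in> space torus_haar \<Longrightarrow> cmod (f \<omega>) \<le> K"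
    using trig_approximable_bounded[OF assms(1)] by blast
  obtain g' where g': "g' \<in> trig_poly" "\<And>\<omega>. \<omega> \<in> space torus_haar \<Longrightarrow> cmod (g \<omega> - g' \<omega>) < e/2/K"
    using trig_approximableD[OF assms(2), of "e/2/K"] e K by auto
  obtain L where L: "L > 0" "\<And>\<omega>. \<omega> \<in> space torus_haar \<Longrightarrow> cmod (g' \<omega>) \<le> L"
    using trig_approximable_bounded[OF trig_approximable_trig_poly[OF g'(1)]] by blast
  obtain f' where f': "f' \<in> trig_poly" "\<And>\<omega>. \<omega> \<in> space torus_haar \<Longrightarrow> cmod (f \<omega> - f' \<omega>) < e/2/L"
    using trig_approximableD[OF assms(1), of "e/2/L"] e L by auto
  have "cmod (f \<omega> * g \<omega> - f' \<omega> * g' \<omega>) < e" if \<omega>: "\<omega> \<in> space torus_haar" for \<omega>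
  proof -
    have "f \<omega> * g \<omega> - f' \<omega> * g' \<omega> = f \<omega> * (g \<omega> - g' \<omega>) + (f \<omega> - f' \<omega>) * g' \<omega>"
      by (simp add: algebra_simps)
    also have "cmod \<dots> \<le> cmod (f \<omega>) * cmod (g \<omega> - g' \<omega>) + cmod (f \<omega> - f' \<omega>) * cmod (g' \<omega>)"
      by (metis norm_mult norm_triangle_ineq)
    also have "\<dots> \<le> K * cmod (g \<omega> - g' \<omega>) + cmod (f \<omega> - f' \<omega>) * L"
      by (intro add_mono mult_right_mono mult_left_mono K L \<omega>) auto
    also have "\<dots> < K * (e/2/K) + (e/2/L) * L"
      by (intro add_strict_mono mult_strict_left_mono mult_strict_right_mono g' f' \<omega> K L)
    also have "\<dots> = e" using K L by simp
    finally show ?thesis .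
  qed
  then show "\<exists>h\<in>trig_poly. \<forall>\<omega>\<in>space torus_haar. cmod (f \<omega> * g \<omega> - h \<omega>) < e"
    by (intro bexI[OF _ trig_poly_mult[OF f'(1) g'(1)]] ballI)
qed

lemma trig_approximable_cnj:
  assumes "trig_approximable f"
  shows "trig_approximable (\<lambda>\<omega>. cnj (f \<omega>))"
  unfolding trig_approximable_def
proof (intro allI impI)
  fix e :: real assume e: "e > 0"
  obtain f' where f': "f' \<in> trig_poly" "\<And>\<omega>. \<omega> \<in> space torus_haar \<Longrightarrow> cmod (f \<omega> - f' \<omega>) < e"
    using trig_approximableD[OF assms(1), of "e"] e by auto
  then show "\<exists>h\<in>trig_poly. \<forall>\<omega>\<in>space torus_haar. cmod (cnj (f \<omega>) - h \<omega>) < e"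
    by (intro bexI[OF _ trig_poly_cnj[OF f'(1)]]) (auto simp flip: complex_cnj_diff)
qed

lemma trig_approximable_real_polynomial:
  fixes u :: "(nat \<Rightarrow> complex) \<Rightarrow> real"
  assumes p: "real_polynomial_function p" and u: "trig_approximable (\<lambda>\<omega>. of_real (u \<omega>))"
  shows "trig_approximable (\<lambda>\<omega>. of_real (p (u \<omega>)))"
  using p
proof (induction p rule: real_polynomial_function.induct)
  case (linear f)
  interpret f: bounded_linear f by fact
  have "f x = f 1 * x" for x
    using f.scaleR[of x 1] by simp
  then have "complex_of_real (f (u \<omega>)) = of_real (f 1) * of_real (u \<omega>)" for \<omega>
    by (metis of_real_mult)
  then show ?case
    using trig_approximable_mult[OF trig_approximable_trig_poly[OF trig_poly_const] u] by simp
next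
  case (const c)
  show ?case by (rule trig_approximable_trig_poly[OF trig_poly_const])
next
  case (add f g)
  then show ?case by (simp add: trig_approximable_add)
next
  case (mult f g)
  then show ?case by (simp add: trig_approximable_mult)
qed

lemma cmod_diff_three_steps:
  fixes w x y z :: complex
  assumes "cmod (w - x) \<le> r" "cmod (x - y) < s" "cmod (z - y) \<le> t"
  shows "cmod (w - z) < r + s + t"
proof -
  have "dist w z \<le> dist w x + dist x y + dist z y"
  proof -
    have "dist w z \<le> dist w y + dist y z" by (rule dist_triangle)
    also have "dist w y \<le> dist w x + dist x y" by (rule dist_triangle)
    finally show ?thesis by (simp add: dist_commute)
  qed
  then show ?thesis using assms unfolding dist_norm by linarith
qed

text \<open>Both sides are continuous in the uniform norm, uniformly in the length of the averaging interval.\<close>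

lemma tendsto_flow_mean:
  assumes h: "trig_approximable h" and [measurable]: "h \<in> borel_measurable torus_haar"
    and cont: "continuous_on UNIV (\<lambda>t. h (flow t (\<lambda>_. 1)))"
  shows "(flow_mean h \<longlongrightarrow> (\<integral>\<omega>. h \<omega> \<partial>torus_haar)) at_top"
proof (rule tendstoI)
  fix e :: real assume e: "e > 0"
  have "e/4 > 0" using e by simp
  from trig_approximableD[OF h this]
  obtain g where g: "g \<in> trig_poly" "\<And>\<omega>. \<omega> \<in> space torus_haar \<Longrightarrow> cmod (h \<omega> - g \<omega>) < e/4"
    by blast
  have int: "integrable torus_haar f" if f: "trig_approximable f" "f \<in> borel_measurable torus_haar" for f
  proof -
    obtain K where "K > 0" "\<And>\<omega>. \<omega> \<in> space torus_haar \<Longrightarrow> cmod (f \<omega>) \<le> K"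
      using trig_approximable_bounded[OF f(1)] by blast
    then show ?thesis
      using f(2) by (intro torus.integrable_const_bound[where B = K] AE_I2)
  qed
  have ig: "integrable torus_haar g"
    using g(1) by (intro int trig_approximable_trig_poly measurable_trig_poly)
  have ih: "integrable torus_haar h"
    by (intro int h) measurable
  have "cmod ((\<integral>\<omega>. h \<omega> \<partial>torus_haar) - (\<integral>\<omega>. g \<omega> \<partial>torus_haar)) = cmod (\<integral>\<omega>. h \<omega> - g \<omega> \<partial>torus_haar)"
    using ig ih by simp
  also have "\<dots> \<le> (\<integral>\<omega>. cmod (h \<omega> - g \<omega>) \<partial>torus_haar)"
    by (rule integral_norm_bound)
  also have "\<dots> \<le> (\<integral>\<omega>. e/4 \<partial>torus_haar)"
    using ig ih g(2) by (intro integral_mono integrable_norm Bochner_Integration.integrable_diff) (auto intro: less_imp_le)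
  also have "\<dots> = e/4" by (simp add: torus.prob_space)
  finally have I: "cmod ((\<integral>\<omega>. h \<omega> \<partial>torus_haar) - (\<integral>\<omega>. g \<omega> \<partial>torus_haar)) \<le> e/4" .
  have "\<forall>\<^sub>F T in at_top. dist (flow_mean g T) (\<integral>\<omega>. g \<omega> \<partial>torus_haar) < e/4"
    using tendsto_flow_mean_trig_poly[OF g(1)] e by (intro tendstoD) auto
  then show "\<forall>\<^sub>F T in at_top. dist (flow_mean h T) (\<integral>\<omega>. h \<omega> \<partial>torus_haar) < e"
    using eventually_gt_at_top[of 0]
  proof eventually_elim
    case (elim T)
    have ih: "set_integrable lborel {-T..T} (\<lambda>t. h (flow t (\<lambda>_. 1)))"
      by (intro borel_integrable_atLeastAtMost' continuous_on_subset[OF cont]) auto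
    have ig: "set_integrable lborel {-T..T} (\<lambda>t. g (flow t (\<lambda>_. 1)))"
      by (intro borel_integrable_atLeastAtMost' continuous_trig_poly_flow g)
    have "flow_mean h T - flow_mean g T = inverse (2 * T) *\<^sub>R (LBINT t:{-T..T}. h (flow t (\<lambda>_. 1)) - g (flow t (\<lambda>_. 1)))"
      using ih ig by (simp add: flow_mean_def set_integral_diff scaleR_diff_right)
    also have "cmod \<dots> = inverse (2 * T) * cmod (LBINT t:{-T..T}. h (flow t (\<lambda>_. 1)) - g (flow t (\<lambda>_. 1)))"
      using elim by simp
    also have "\<dots> \<le> inverse (2 * T) * (LBINT t:{-T..T}. cmod (h (flow t (\<lambda>_. 1)) - g (flow t (\<lambda>_. 1))))"
      using elim ih ig by (intro mult_left_mono set_integral_norm_bound set_integral_diff) auto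
    also have "\<dots> \<le> inverse (2 * T) * (LBINT t:{-T..T}. e/4)"
      using elim ih ig g(2)[OF flow_space[OF one_in_torus]]
      by (intro mult_left_mono set_integral_mono set_integrable_norm set_integral_diff)
         (auto simp: set_integrable_def intro: less_imp_le)
    also have "\<dots> = e/4" using elim by (simp add: set_lebesgue_integral_def)
    finally have A: "cmod (flow_mean h T - flow_mean g T) \<le> e/4" .
    have B: "cmod (flow_mean g T - (\<integral>\<omega>. g \<omega> \<partial>torus_haar)) < e/4"
      using elim by (simp add: dist_norm)
    have "cmod (flow_mean h T - (\<integral>\<omega>. h \<omega> \<partial>torus_haar)) < e/4 + e/4 + e/4"
      by (rule cmod_diff_three_steps[OF A B I])
    then show ?case
      using e by (simp add: dist_norm)
  qed
qed

context unif_dirichlet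
begin

lemma trig_approximable_F:
  assumes "Re s > 0"
  shows "trig_approximable (\<lambda>\<omega>. F \<omega> s)"
proof (rule trig_approximable_limit)
  fix e :: real assume "e > 0"
  then obtain N where N: "\<And>\<omega> z n. \<omega> \<in> space torus_haar \<Longrightarrow> Re z > Re s / 2 \<Longrightarrow> n \<ge> N \<Longrightarrow> cmod (psum n \<omega> z - F \<omega> z) < e"
    using uniform_approx[of "Re s / 2" e] assms by auto
  have "(\<lambda>\<omega>. psum N \<omega> s) \<in> trig_poly"
  proof (rule trig_poly_sum)
    fix n assume "n \<in> {1..N}"
    then show "(\<lambda>\<omega>. dterm (twist a \<omega>) n s) \<in> trig_poly"
      using trig_poly.monomial[of n 1 "a n * of_nat n powr (- s)"]
      by (simp add: dterm_def twist_def mult_ac)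
  qed
  then show "\<exists>g. trig_approximable g \<and> (\<forall>\<omega>\<in>space torus_haar. cmod (F \<omega> s - g \<omega>) < e)"
    using N[of _ s N] assms by (intro exI[of _ "\<lambda>\<omega>. psum N \<omega> s"])
      (auto intro: trig_approximable_trig_poly simp: norm_minus_commute)
qed

text \<open>By Weierstrass, \<open>\<Phi>(|z|)\<close> is on discs a uniform limit of polynomials in \<open>|z|\<^sup>2 = z * cnj z\<close>, and the uniform
limits of trigonometric polynomials are closed under sums, products and conjugation. So the approximation
problem on the torus reduces to one on an interval.\<close>

lemma trig_approximable_Phi:
  assumes "\<sigma> > 0" and \<Phi>: "continuous_on {0..} \<Phi>"
  shows "trig_approximable (\<lambda>\<omega>. of_real (\<Phi> (cmod (F \<omega> (of_real \<sigma>)))))"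
proof (rule trig_approximable_limit)
  fix e :: real assume e: "e > 0"
  obtain K where K: "K > 0" "\<And>\<omega> s. \<omega> \<in> space torus_haar \<Longrightarrow> Re s > \<sigma>/2 \<Longrightarrow> cmod (F \<omega> s) < K"
    using F_bounded[of "\<sigma>/2"] assms by auto
  have "continuous_on {0..K\<^sup>2} (\<lambda>x. \<Phi> (sqrt x))"
    by (intro continuous_on_compose2[OF \<Phi>] continuous_intros) auto
  then obtain p where p: "real_polynomial_function p" "\<And>x. x \<in> {0..K\<^sup>2} \<Longrightarrow> \<bar>\<Phi> (sqrt x) - p x\<bar> < e"
    using Stone_Weierstrass_real_polynomial_function[of "{0..K\<^sup>2}" "\<lambda>x. \<Phi> (sqrt x)" e] e by auto
  let ?g = "\<lambda>\<omega>. complex_of_real (p ((cmod (F \<omega> (of_real \<sigma>)))\<^sup>2))"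
  have "trig_approximable (\<lambda>\<omega>. F \<omega> (of_real \<sigma>) * cnj (F \<omega> (of_real \<sigma>)))"
    using assms by (intro trig_approximable_mult trig_approximable_cnj trig_approximable_F) auto
  then have "trig_approximable ?g"
    by (intro trig_approximable_real_polynomial[OF p(1)]) (simp only: complex_norm_square)
  moreover have "cmod (of_real (\<Phi> (cmod (F \<omega> (of_real \<sigma>)))) - ?g \<omega>) < e" if "\<omega> \<in> space torus_haar" for \<omega>
  proof -
    have "cmod (F \<omega> (of_real \<sigma>)) < K" using K(2)[OF that, of "of_real \<sigma>"] assms by simp
    then have "(cmod (F \<omega> (of_real \<sigma>)))\<^sup>2 \<in> {0..K\<^sup>2}" by (auto intro: power_mono)
    from p(2)[OF this] show ?thesis
      by (simp flip: of_real_diff)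
  qed
  ultimately show "\<exists>g. trig_approximable g \<and> (\<forall>\<omega>\<in>space torus_haar.
      cmod (of_real (\<Phi> (cmod (F \<omega> (of_real \<sigma>)))) - g \<omega>) < e)" by blast
qed

lemma vertical_mean_eq:
  assumes "\<sigma> > 0" and \<Phi>: "continuous_on {0..} \<Phi>"
    and [measurable]: "\<Phi> \<in> borel_measurable borel"
  shows "vertical_mean \<Phi> a \<sigma> = (\<integral>\<omega>. \<Phi> (cmod (F \<omega> (of_real \<sigma>))) \<partial>torus_haar)"
proof -
  let ?h = "\<lambda>\<omega>. complex_of_real (\<Phi> (cmod (F \<omega> (of_real \<sigma>))))"
  have F1: "F (flow t (\<lambda>_. 1)) (of_real \<sigma>) = dseries a (Complex \<sigma> t)" for t
    by (simp add: vertical_limit_flow vertical_limit_one complex_eq_iff Complex_eq)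
  have "continuous_on UNIV (\<lambda>t. dseries a (Complex \<sigma> t))"
  proof (rule continuous_on_compose2[of "right_half_plane 0" "dseries a" UNIV "Complex \<sigma>"])
    show "continuous_on (right_half_plane 0) (dseries a)"
      using holomorphic_on_imp_continuous_on[OF F_holomorphic[OF one_in_torus]]
      by (simp add: vertical_limit_one)
    show "continuous_on UNIV (Complex \<sigma>)"
      unfolding Complex_eq by (intro continuous_intros)
    show "Complex \<sigma> ` UNIV \<subseteq> right_half_plane 0"
      using assms by (auto simp: right_half_plane_def)
  qed
  then have "continuous_on UNIV (\<lambda>t. ?h (flow t (\<lambda>_. 1)))"
    unfolding F1 by (intro continuous_intros continuous_on_compose2[OF \<Phi>]) auto
  then have "(flow_mean ?h \<longlongrightarrow> (\<integral>\<omega>. ?h \<omega> \<partial>torus_haar)) at_top"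
    by (intro tendsto_flow_mean trig_approximable_Phi assms) measurable
  also have "flow_mean ?h = (\<lambda>T. complex_of_real (1 / (2 * T) * (LBINT t:{-T..T}. \<Phi> (cmod (dseries a (Complex \<sigma> t))))))"
  proof
    fix T
    have "flow_mean ?h T = inverse (2 * T) *\<^sub>R complex_of_real (LBINT t:{-T..T}. \<Phi> (cmod (dseries a (Complex \<sigma> t))))"
      unfolding flow_mean_def F1 set_integral_complex_of_real ..
    then show "flow_mean ?h T = complex_of_real (1 / (2 * T) * (LBINT t:{-T..T}. \<Phi> (cmod (dseries a (Complex \<sigma> t)))))"
      by (simp only: scaleR_conv_of_real of_real_mult divide_inverse mult_1_left)
  qed
  also have "(\<integral>\<omega>. ?h \<omega> \<partial>torus_haar) = complex_of_real (\<integral>\<omega>. \<Phi> (cmod (F \<omega> (of_real \<sigma>))) \<partial>torus_haar)"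
    by (rule integral_complex_of_real)
  finally have "((\<lambda>T. 1 / (2 * T) * (LBINT t:{-T..T}. \<Phi> (cmod (dseries a (Complex \<sigma> t)))))
      \<longlongrightarrow> (\<integral>\<omega>. \<Phi> (cmod (F \<omega> (of_real \<sigma>))) \<partial>torus_haar)) at_top"
    unfolding tendsto_of_real_iff .
  then show ?thesis
    unfolding vertical_mean_def by (rule tendsto_Lim[OF trivial_limit_at_top_linorder])
qed

end

section \<open>A regularised logarithm and its Laplacian\<close>

text \<open>With \<open>x = |w|\<^sup>2\<close> this is \<open>ln (1 + sqrt (e\<^sup>2 + |w|\<^sup>2))\<close>, a smooth function of \<open>w\<close> that tends to \<open>ln (1 + |w|)\<close> as \<open>e\<close>
tends to \<open>0\<close>. The functions \<open>psi1\<close> and \<open>psi2\<close> are its first two derivatives in \<open>x\<close>.\<close>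

definition psi :: "real \<Rightarrow> real \<Rightarrow> real" where
  "psi e x = ln (1 + sqrt (e\<^sup>2 + x))"

definition psi1 :: "real \<Rightarrow> real \<Rightarrow> real" where
  "psi1 e x = (let q = sqrt (e\<^sup>2 + x) in 1 / (2 * q * (1 + q)))"

definition psi2 :: "real \<Rightarrow> real \<Rightarrow> real" where
  "psi2 e x = (let q = sqrt (e\<^sup>2 + x) in - (1 + 2 * q) / (4 * q ^ 3 * (1 + q)\<^sup>2))"

lemma psi_derivs:
  assumes "e > 0" "x \<ge> 0"
  shows "(psi e has_real_derivative psi1 e x) (at x)"
    and "(psi1 e has_real_derivative psi2 e x) (at x)"
proof -
  define q where "q = sqrt (e\<^sup>2 + x)"
  have pos: "e\<^sup>2 + x > 0" using assms by (simp add: add_pos_nonneg)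
  then have q: "q > 0" by (simp add: q_def)
  have dq: "((\<lambda>x. sqrt (e\<^sup>2 + x)) has_real_derivative 1 / (2 * q)) (at x)"
    using pos by (auto intro!: derivative_eq_intros simp: q_def divide_simps)
  show "(psi e has_real_derivative psi1 e x) (at x)"
    unfolding psi_def[abs_def] psi1_def Let_def q_def[symmetric]
    using q pos by (auto intro!: derivative_eq_intros dq simp: q_def[symmetric] divide_simps)
  have "((\<lambda>x. 1 / (2 * sqrt (e\<^sup>2 + x) * (1 + sqrt (e\<^sup>2 + x)))) has_real_derivative
      - (2 * (1 / (2 * q)) * (1 + q) + 2 * q * (1 / (2 * q))) / (2 * q * (1 + q))\<^sup>2) (at x)"
  proof -
    have "((\<lambda>x. 1 / (2 * g x * (1 + g x))) has_real_derivative
        - (2 * d * (1 + q) + 2 * q * d) / (2 * q * (1 + q))\<^sup>2) (at x)"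
      if "(g has_real_derivative d) (at x)" "g x = q" for g d
      using q that by (auto intro!: derivative_eq_intros simp: power2_eq_square)
    from this[OF dq] show ?thesis by (simp add: q_def)
  qed
  also have "- (2 * (1 / (2 * q)) * (1 + q) + 2 * q * (1 / (2 * q))) / (2 * q * (1 + q))\<^sup>2
     = - (1 + 2 * q) / (4 * q ^ 3 * (1 + q)\<^sup>2)"
    using q by (simp add: divide_simps) (simp add: power2_eq_square power3_eq_cube algebra_simps)
  finally show "(psi1 e has_real_derivative psi2 e x) (at x)"
    unfolding psi1_def[abs_def] psi2_def Let_def q_def[symmetric] .
qed

text \<open>The radial function \<open>w \<mapsto> g(|w|\<^sup>2)\<close> on the plane has Laplacian \<open>4 (x g''(x) + g'(x))\<close> at \<open>x = |w|\<^sup>2\<close>.\<close>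

definition lap :: "real \<Rightarrow> real \<Rightarrow> real" where
  "lap e x = 4 * (x * psi2 e x + psi1 e x)"

lemma lap_eq:
  assumes "e \<ge> 0" "x \<ge> 0" "e > 0 \<or> x > 0"
  shows "lap e x = (let q = sqrt (e\<^sup>2 + x) in (q\<^sup>2 + e\<^sup>2 * (1 + 2 * q)) / (q ^ 3 * (1 + q)\<^sup>2))"
proof -
  define q where "q = sqrt (e\<^sup>2 + x)"
  have pos: "e\<^sup>2 + x > 0" using assms by (auto simp: add_pos_nonneg add_nonneg_pos)
  then have q: "q > 0" by (simp add: q_def)
  have x: "x = q\<^sup>2 - e\<^sup>2" using pos by (simp add: q_def)
  show ?thesis
    unfolding lap_def psi1_def psi2_def Let_def q_def[symmetric] unfolding x using q
    by (simp add: divide_simps) (simp add: power2_eq_square power3_eq_cube algebra_simps)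
qed

text \<open>The integrand of the area integral for \<open>w = f(s)\<close> and \<open>v = f'(s)\<close>, with the value \<open>0\<close> at the zeros of \<open>f\<close>.\<close>

definition area_kernel :: "complex \<Rightarrow> complex \<Rightarrow> real" where
  "area_kernel w v = (if w = 0 then 0 else (cmod v)\<^sup>2 / (cmod w * (1 + cmod w)\<^sup>2))"

lemma lap_0: "w \<noteq> 0 \<Longrightarrow> lap 0 ((cmod w)\<^sup>2) * (cmod v)\<^sup>2 = area_kernel w v"
  by (simp add: lap_eq Let_def area_kernel_def divide_simps power2_eq_square power3_eq_cube)

lemma lap_nonneg: "e > 0 \<Longrightarrow> x \<ge> 0 \<Longrightarrow> lap e x \<ge> 0"
  by (auto simp: lap_eq Let_def)

text \<open>With \<open>q = sqrt (e\<^sup>2 + |w|\<^sup>2)\<close> the numerator \<open>q\<^sup>2 + e\<^sup>2 (1 + 2 q)\<close> is at most \<open>4 q\<^sup>2\<close>, because \<open>e \<le> 1\<close> and \<open>e \<le> q\<close>.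
This bound is the majorant for the limit \<open>e \<rightarrow> 0\<close>.\<close>

lemma lap_le_area_kernel:
  assumes e: "0 < e" "e \<le> 1" and w: "w \<noteq> 0"
  shows "lap e ((cmod w)\<^sup>2) * (cmod v)\<^sup>2 \<le> 4 * area_kernel w v"
proof -
  define r where "r = cmod w"
  define q where "q = sqrt (e\<^sup>2 + r\<^sup>2)"
  have r: "r > 0" using w by (simp add: r_def)
  have q: "r \<le> q" "e \<le> q" "q > 0"
    unfolding q_def using e r by (auto intro: real_le_rsqrt add_pos_pos)
  have "lap e (r\<^sup>2) = (q\<^sup>2 + e\<^sup>2 * (1 + 2 * q)) / (q ^ 3 * (1 + q)\<^sup>2)"
    using e by (simp add: lap_eq Let_def q_def)
  also have "\<dots> \<le> (q\<^sup>2 + 3 * q\<^sup>2) / (q ^ 3 * (1 + q)\<^sup>2)"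
  proof (intro divide_right_mono add_left_mono)
    have "e\<^sup>2 \<le> q\<^sup>2" using e q by (intro power_mono) auto
    moreover have "e * (e * q) \<le> 1 * (q * q)"
      using e q by (intro mult_mono[of e 1] mult_right_mono) auto
    ultimately show "e\<^sup>2 * (1 + 2 * q) \<le> 3 * q\<^sup>2"
      by (simp add: power2_eq_square algebra_simps)
  qed (use q in auto)
  also have "\<dots> = 4 / (q * (1 + q)\<^sup>2)"
    using q by (simp add: divide_simps power2_eq_square power3_eq_cube)
  also have "\<dots> \<le> 4 / (r * (1 + r)\<^sup>2)"
    using q r by (intro divide_left_mono mult_mono power_mono mult_pos_pos) auto
  finally have "lap e (r\<^sup>2) * (cmod v)\<^sup>2 \<le> 4 / (r * (1 + r)\<^sup>2) * (cmod v)\<^sup>2"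
    by (rule mult_right_mono) simp
  then show ?thesis using w by (simp add: area_kernel_def r_def)
qed

lemma tendsto_lap:
  assumes "x > 0" "\<epsilon> \<longlonglongrightarrow> 0" "\<And>n. \<epsilon> n \<ge> 0"
  shows "(\<lambda>n. lap (\<epsilon> n) x) \<longlonglongrightarrow> lap 0 x"
proof -
  have "1 + sqrt x > 0" using assms by (simp add: add_pos_nonneg)
  then show ?thesis
    unfolding lap_def psi1_def psi2_def Let_def using assms
    by (intro tendsto_intros) (auto intro!: tendsto_eq_intros)
qed

lemma psi_bounds:
  assumes "e > 0" "x \<ge> 0"
  shows "\<bar>psi1 e x\<bar> \<le> 1 / (2 * e)" "\<bar>psi2 e x\<bar> \<le> 1 / (2 * e ^ 3)"
proof -
  define q where "q = sqrt (e\<^sup>2 + x)"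
  have q: "q \<ge> e" "q > 0" unfolding q_def using assms
    by (auto intro: real_le_rsqrt add_pos_nonneg)
  have "psi1 e x = 1 / (2 * q * (1 + q))" by (simp add: psi1_def q_def Let_def)
  moreover have "1 / (2 * q * (1 + q)) \<le> 1 / (2 * e)"
  proof (rule divide_left_mono)
    have "2 * e * 1 \<le> 2 * q * (1 + q)" using q assms by (intro mult_mono) auto
    then show "2 * e \<le> 2 * q * (1 + q)" by simp
  qed (use q assms in auto)
  ultimately show "\<bar>psi1 e x\<bar> \<le> 1 / (2 * e)" using q by simp
  have "\<bar>psi2 e x\<bar> = (1 + 2 * q) / (4 * q ^ 3 * (1 + q)\<^sup>2)"
    using q by (simp add: psi2_def q_def[symmetric] abs_divide abs_mult Let_def)
  also have "\<dots> \<le> (2 * (1 + q)\<^sup>2) / (4 * q ^ 3 * (1 + q)\<^sup>2)"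
    using q by (intro divide_right_mono) (auto simp: power2_eq_square algebra_simps)
  also have "\<dots> = 1 / (2 * q ^ 3)" using q by (simp add: divide_simps)
  also have "\<dots> \<le> 1 / (2 * e ^ 3)"
    using q assms by (intro divide_left_mono mult_left_mono power_mono) auto
  finally show "\<bar>psi2 e x\<bar> \<le> 1 / (2 * e ^ 3)" .
qed

lemma psi_approx:
  assumes "e > 0"
  shows "\<bar>psi e ((cmod w)\<^sup>2) - ln (1 + cmod w)\<bar> \<le> e"
proof -
  define r where "r = cmod w"
  define q where "q = sqrt (e\<^sup>2 + r\<^sup>2)"
  have r: "r \<ge> 0" by (simp add: r_def)
  have q: "r \<le> q" unfolding q_def using r by (intro real_le_rsqrt) auto
  have q': "q \<le> r + e" unfolding q_def using r assms
    by (intro real_le_lsqrt) (auto simp: power2_eq_square algebra_simps)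
  have "ln (1 + q) - ln (1 + r) = ln ((1 + q) / (1 + r))" using q r by (simp add: ln_div)
  also have "\<dots> \<le> (1 + q) / (1 + r) - 1" using q r by (intro ln_le_minus_one) auto
  also have "\<dots> = (q - r) / (1 + r)" using r by (simp add: field_simps)
  also have "\<dots> \<le> (q - r) / 1" using q r by (intro divide_left_mono) auto
  finally have "ln (1 + q) - ln (1 + r) \<le> e" using q' by simp
  moreover have "ln (1 + r) \<le> ln (1 + q)" using q r by simp
  ultimately show ?thesis by (simp add: psi_def q_def r_def)
qed

text \<open>If \<open>w\<close>, \<open>v\<close>, \<open>u\<close> are the position, velocity and acceleration of a curve in the plane, then \<open>dpsi1\<close> and \<open>dpsi2\<close> are
the first and second derivative of \<open>psi e (|w|\<^sup>2)\<close> along the curve.\<close>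

definition dpsi1 :: "real \<Rightarrow> complex \<Rightarrow> complex \<Rightarrow> real" where
  "dpsi1 e w v = psi1 e ((cmod w)\<^sup>2) * (2 * (w \<bullet> v))"

definition dpsi2 :: "real \<Rightarrow> complex \<Rightarrow> complex \<Rightarrow> complex \<Rightarrow> real" where
  "dpsi2 e w v u = psi2 e ((cmod w)\<^sup>2) * (2 * (w \<bullet> v))\<^sup>2
     + psi1 e ((cmod w)\<^sup>2) * (2 * ((cmod v)\<^sup>2 + w \<bullet> u))"

lemma psi_along_curve:
  assumes e: "e > 0"
    and w: "(w has_vector_derivative v x) (at x within A)"
    and v: "(v has_vector_derivative u) (at x within A)"
  shows "((\<lambda>x. psi e ((cmod (w x))\<^sup>2)) has_real_derivative dpsi1 e (w x) (v x)) (at x within A)"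
    and "((\<lambda>x. dpsi1 e (w x) (v x)) has_real_derivative dpsi2 e (w x) (v x) u) (at x within A)"
proof -
  note w' = w[unfolded has_vector_derivative_def]
  note v' = v[unfolded has_vector_derivative_def]
  have h: "((\<lambda>x. (cmod (w x))\<^sup>2) has_real_derivative 2 * (w x \<bullet> v x)) (at x within A)"
    unfolding power2_norm_eq_inner has_field_derivative_def
    by (rule derivative_eq_intros w' refl)+ (simp add: fun_eq_iff inner_commute)
  have h': "((\<lambda>x. 2 * (w x \<bullet> v x)) has_real_derivative 2 * ((cmod (v x))\<^sup>2 + w x \<bullet> u)) (at x within A)"
    unfolding power2_norm_eq_inner has_field_derivative_def
    by (rule derivative_eq_intros w' v' refl)+ (simp add: fun_eq_iff inner_commute algebra_simps)
  show "((\<lambda>x. psi e ((cmod (w x))\<^sup>2)) has_real_derivative dpsi1 e (w x) (v x)) (at x within A)"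
    unfolding dpsi1_def using DERIV_chain2[OF psi_derivs(1)[OF e] h] by simp
  have "((\<lambda>x. psi1 e ((cmod (w x))\<^sup>2)) has_real_derivative psi2 e ((cmod (w x))\<^sup>2) * (2 * (w x \<bullet> v x))) (at x within A)"
    using DERIV_chain2[OF psi_derivs(2)[OF e] h] by simp
  from DERIV_mult[OF this h']
  show "((\<lambda>x. dpsi1 e (w x) (v x)) has_real_derivative dpsi2 e (w x) (v x) u) (at x within A)"
    unfolding dpsi1_def dpsi2_def by (simp add: power2_eq_square algebra_simps)
qed

text \<open>Along a horizontal line the curve \<open>f(s)\<close> has velocity \<open>f'\<close> and acceleration \<open>f''\<close>, along a vertical line \<open>i f'\<close> and
\<open>- f''\<close>. In the sum the terms with \<open>f''\<close> cancel, and only \<open>|f'|\<^sup>2\<close> remains.\<close>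

lemma dpsi_laplacian: "dpsi2 e w v u + dpsi2 e w (\<i> * v) (- u) = lap e ((cmod w)\<^sup>2) * (cmod v)\<^sup>2"
proof -
  have "(w \<bullet> v)\<^sup>2 + (w \<bullet> (\<i> * v))\<^sup>2 = (cmod w)\<^sup>2 * (cmod v)\<^sup>2"
    unfolding cmod_power2 inner_complex_def by (simp add: power2_eq_square algebra_simps)
  then have *: "(w \<bullet> (\<i> * v))\<^sup>2 = (cmod w)\<^sup>2 * (cmod v)\<^sup>2 - (w \<bullet> v)\<^sup>2" by simp
  show ?thesis
    by (simp add: dpsi2_def lap_def norm_mult power_mult_distrib * algebra_simps)
qed

lemma dpsi1_bound:
  assumes "e > 0" "cmod w \<le> K" "cmod v \<le> K"
  shows "\<bar>dpsi1 e w v\<bar> \<le> (K * cmod v) / e"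
proof -
  have K: "K \<ge> 0" using assms by (meson norm_ge_zero order_trans)
  have "\<bar>dpsi1 e w v\<bar> \<le> (1 / (2 * e)) * (2 * (K * cmod v))"
    unfolding dpsi1_def abs_mult using K assms
    by (intro mult_mono psi_bounds order_trans[OF Cauchy_Schwarz_ineq2]) (auto intro!: mult_mono order_trans[OF Cauchy_Schwarz_ineq2])
  then show ?thesis by simp
qed

lemma dpsi2_bound:
  assumes "e > 0" "cmod w \<le> K" "cmod v \<le> K" "cmod u \<le> K"
  shows "\<bar>dpsi2 e w v u\<bar> \<le> (1 / (2 * e ^ 3)) * (2 * (K * K))\<^sup>2 + (1 / (2 * e)) * (2 * (K\<^sup>2 + K * K))"
proof -
  have K: "K \<ge> 0" using assms by (meson norm_ge_zero order_trans)
  have wv: "\<bar>w \<bullet> v\<bar> \<le> K * K" and wu: "\<bar>w \<bullet> u\<bar> \<le> K * K"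
    using assms K by (auto intro!: order_trans[OF Cauchy_Schwarz_ineq2] mult_mono)
  have "\<bar>psi2 e ((cmod w)\<^sup>2) * (2 * (w \<bullet> v))\<^sup>2\<bar> \<le> (1 / (2 * e ^ 3)) * (2 * (K * K))\<^sup>2"
    unfolding abs_mult[of "psi2 _ _"] power_abs
    using assms wv by (intro mult_mono psi_bounds power_mono) (auto simp: abs_mult)
  moreover have "\<bar>psi1 e ((cmod w)\<^sup>2) * (2 * ((cmod v)\<^sup>2 + w \<bullet> u))\<bar> \<le> (1 / (2 * e)) * (2 * (K\<^sup>2 + K * K))"
  proof -
    have "(cmod v)\<^sup>2 \<le> K\<^sup>2" using assms by (intro power_mono) auto
    then have "\<bar>2 * ((cmod v)\<^sup>2 + w \<bullet> u)\<bar> \<le> 2 * (K\<^sup>2 + K * K)"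
      using wu zero_le_power2[of "cmod v"] zero_le_power2[of K]
      unfolding abs_le_iff distrib_left by (intro conjI) linarith+
    then show ?thesis
      unfolding abs_mult[of "psi1 _ _"] using assms by (intro mult_mono psi_bounds) auto
  qed
  ultimately show ?thesis unfolding dpsi2_def by linarith
qed

lemma measurable_psi [measurable]: "psi e \<in> borel_measurable borel" "psi1 e \<in> borel_measurable borel"
  "psi2 e \<in> borel_measurable borel" "lap e \<in> borel_measurable borel"
  unfolding lap_def[abs_def] psi_def[abs_def] psi1_def[abs_def] psi2_def[abs_def] Let_def by measurable

lemma measurable_dpsi [measurable (raw)]:
  assumes [measurable]: "w \<in> borel_measurable M" "v \<in> borel_measurable M" "u \<in> borel_measurable M"
  shows "(\<lambda>x. dpsi1 e (w x) (v x)) \<in> borel_measurable M"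
    "(\<lambda>x. dpsi2 e (w x) (v x) (u x)) \<in> borel_measurable M"
    "(\<lambda>x. area_kernel (w x) (v x)) \<in> borel_measurable M"
  unfolding dpsi1_def dpsi2_def area_kernel_def by measurable

section \<open>A Taylor formula for the regularised means\<close>

interpretation torus_line: pair_sigma_finite torus_haar "lborel :: real measure"
  by unfold_locales

lemma integrable_torus_strip:
  fixes g :: "(nat \<Rightarrow> complex) \<Rightarrow> real \<Rightarrow> real"
  assumes [measurable]: "case_prod g \<in> borel_measurable (torus_haar \<Otimes>\<^sub>M lborel)"
    and bound: "\<And>\<omega> x. \<omega> \<in> space torus_haar \<Longrightarrow> x \<in> {a..b} \<Longrightarrow> \<bar>g \<omega> x\<bar> \<le> K"
  shows "integrable (torus_haar \<Otimes>\<^sub>M lborel) (\<lambda>(\<omega>, x). indicator {a..b} x * g \<omega> x)"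
proof -
  let ?A = "space torus_haar \<times> {a..b}"
  have "integrable (torus_haar \<Otimes>\<^sub>M lborel) (\<lambda>p. indicator ?A p *\<^sub>R (case_prod g) p)"
  proof (rule integrableI_bounded_set_indicator)
    show "emeasure (torus_haar \<Otimes>\<^sub>M lborel) ?A < \<infinity>"
      by (subst lborel.emeasure_pair_measure_Times)
         (auto simp: torus.emeasure_space_1 emeasure_lborel_Icc_eq)
    show "AE p in torus_haar \<Otimes>\<^sub>M lborel. p \<in> ?A \<longrightarrow> norm (case_prod g p) \<le> K"
      using bound by (intro AE_I2) auto
  qed (auto intro: pair_measureI)
  then show ?thesis
    by (rule Bochner_Integration.integrable_cong[THEN iffD1, OF refl, rotated])
       (auto simp: space_pair_measure indicator_def split: if_splits)
qed

lemma integral_torus_strip: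
  fixes g :: "(nat \<Rightarrow> complex) \<Rightarrow> real \<Rightarrow> real"
  assumes "case_prod g \<in> borel_measurable (torus_haar \<Otimes>\<^sub>M lborel)"
    and "\<And>\<omega> x. \<omega> \<in> space torus_haar \<Longrightarrow> x \<in> {a..b} \<Longrightarrow> \<bar>g \<omega> x\<bar> \<le> K"
  shows "(\<integral>\<omega>. (LBINT x:{a..b}. g \<omega> x) \<partial>torus_haar) = (LBINT x:{a..b}. (\<integral>\<omega>. g \<omega> x \<partial>torus_haar))"
  using torus_line.Fubini_integral[OF integrable_torus_strip[OF assms]]
  by (simp add: set_lebesgue_integral_def)

context unif_dirichlet
begin

lemma F_vector_derivs:
  assumes \<omega>: "\<omega> \<in> space torus_haar" and s: "Re (z + of_real x * d) > 0"
  shows "((\<lambda>x. F \<omega> (z + of_real x * d)) has_vector_derivative d * F1 \<omega> (z + of_real x * d)) (at x within A)"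
    and "((\<lambda>x. d * F1 \<omega> (z + of_real x * d)) has_vector_derivative d\<^sup>2 * F2 \<omega> (z + of_real x * d)) (at x within A)"
proof -
  have line: "((\<lambda>x. z + of_real x * d) has_vector_derivative d) (at x within A)"
    by (auto intro!: derivative_eq_intros simp: has_vector_derivative_def scaleR_conv_of_real)
  show "((\<lambda>x. F \<omega> (z + of_real x * d)) has_vector_derivative d * F1 \<omega> (z + of_real x * d)) (at x within A)"
    using field_vector_diff_chain_within[OF line, of "F \<omega>" "F1 \<omega> (z + of_real x * d)"]
      F_has_derivative(1)[OF \<omega> s] by (auto simp: o_def intro: has_field_derivative_at_within)
  have "((\<lambda>x. F1 \<omega> (z + of_real x * d)) has_vector_derivative d * F2 \<omega> (z + of_real x * d)) (at x within A)"
    using field_vector_diff_chain_within[OF line, of "F1 \<omega>" "F2 \<omega> (z + of_real x * d)"]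
      F_has_derivative(2)[OF \<omega> s] by (auto simp: o_def intro: has_field_derivative_at_within)
  from has_vector_derivative_mult_right[OF this, of d]
  show "((\<lambda>x. d * F1 \<omega> (z + of_real x * d)) has_vector_derivative d\<^sup>2 * F2 \<omega> (z + of_real x * d)) (at x within A)"
    by (simp add: power2_eq_square mult.assoc)
qed

lemma F_jet_continuous:
  assumes "\<omega> \<in> space torus_haar"
  shows "continuous_on (right_half_plane 0) (F \<omega>)" "continuous_on (right_half_plane 0) (F1 \<omega>)"
    "continuous_on (right_half_plane 0) (F2 \<omega>)"
proof -
  have o: "open (right_half_plane 0)"
    unfolding right_half_plane_def by (rule open_halfspace_Re_gt)
  note hol = F_holomorphic[OF assms]
  show "continuous_on (right_half_plane 0) (F \<omega>)"
    by (rule holomorphic_on_imp_continuous_on[OF hol])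
  show "continuous_on (right_half_plane 0) (F1 \<omega>)"
    by (rule continuous_on_eq[OF holomorphic_on_imp_continuous_on[OF holomorphic_deriv[OF hol o]]])
       (simp add: F1_def right_half_plane_def)
  show "continuous_on (right_half_plane 0) (F2 \<omega>)"
    by (rule continuous_on_eq[OF holomorphic_on_imp_continuous_on[OF holomorphic_deriv[OF holomorphic_deriv[OF hol o] o]]])
       (simp add: F2_def right_half_plane_def)
qed

lemma F_jet_bounded:
  assumes "\<theta> > 0"
  obtains K where "K > 0" "\<And>\<omega> s. \<omega> \<in> space torus_haar \<Longrightarrow> Re s \<ge> \<theta> \<Longrightarrow>
    cmod (F \<omega> s) \<le> K \<and> cmod (F1 \<omega> s) \<le> K \<and> cmod (F2 \<omega> s) \<le> K"
proof -
  have \<theta>: "\<theta>/2 > 0" using assms by simp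
  obtain K0 where K0: "K0 > 0" "\<And>\<omega> s. \<omega> \<in> space torus_haar \<Longrightarrow> Re s > \<theta>/2 \<Longrightarrow> cmod (F \<omega> s) < K0"
    using F_bounded[OF \<theta>] by blast
  obtain K1 where K1: "K1 > 0" "\<And>\<omega> s. \<omega> \<in> space torus_haar \<Longrightarrow> Re s > \<theta>/2 \<Longrightarrow> cmod ((deriv ^^ 1) (F \<omega>) s) \<le> K1"
    using F_derivs_bounded[OF \<theta> zero_less_one] by blast
  obtain K2 where K2: "K2 > 0" "\<And>\<omega> s. \<omega> \<in> space torus_haar \<Longrightarrow> Re s > \<theta>/2 \<Longrightarrow> cmod ((deriv ^^ 2) (F \<omega>) s) \<le> K2"
    using F_derivs_bounded[OF \<theta>, of 2, OF zero_less_numeral] by blast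
  show ?thesis
  proof (rule that[of "K0 + K1 + K2"])
    fix \<omega> s assume \<omega>: "\<omega> \<in> space torus_haar" and s: "Re s \<ge> \<theta>"
    then have s': "Re s > \<theta>/2" "Re s > 0" using assms by auto
    have "cmod (F \<omega> s) < K0" by (rule K0(2)[OF \<omega> s'(1)])
    moreover have "cmod (F1 \<omega> s) \<le> K1" using K1(2)[OF \<omega> s'(1)] s' by (simp add: F1_def)
    moreover have "cmod (F2 \<omega> s) \<le> K2" using K2(2)[OF \<omega> s'(1)] s' by (simp add: F2_def numeral_2_eq_2)
    ultimately show "cmod (F \<omega> s) \<le> K0 + K1 + K2 \<and> cmod (F1 \<omega> s) \<le> K0 + K1 + K2 \<and> cmod (F2 \<omega> s) \<le> K0 + K1 + K2"
      using K0(1) K1(1) K2(1) by linarith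
  qed (use K0 K1 K2 in auto)
qed

text \<open>The directional derivatives of first and second order of \<open>psi e (|f\<^sub>\<omega>|\<^sup>2)\<close> in the direction \<open>d\<close>.\<close>

definition D1 :: "real \<Rightarrow> complex \<Rightarrow> (nat \<Rightarrow> complex) \<Rightarrow> complex \<Rightarrow> real" where
  "D1 e d \<omega> s = dpsi1 e (F \<omega> s) (d * F1 \<omega> s)"

definition D2 :: "real \<Rightarrow> complex \<Rightarrow> (nat \<Rightarrow> complex) \<Rightarrow> complex \<Rightarrow> real" where
  "D2 e d \<omega> s = dpsi2 e (F \<omega> s) (d * F1 \<omega> s) (d\<^sup>2 * F2 \<omega> s)"

lemma measurable_D [measurable (raw)]:
  assumes [measurable]: "w \<in> M \<rightarrow>\<^sub>M torus_haar" "s \<in> borel_measurable M"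
  shows "(\<lambda>x. D1 e d (w x) (s x)) \<in> borel_measurable M"
    and "(\<lambda>x. D2 e d (w x) (s x)) \<in> borel_measurable M"
  unfolding D1_def D2_def by measurable

lemma D_flow:
  assumes "\<omega> \<in> space torus_haar"
  shows "D1 e d (flow t \<omega>) s = D1 e d \<omega> (s + \<i> * t)" "D2 e d (flow t \<omega>) s = D2 e d \<omega> (s + \<i> * t)"
  by (simp_all add: D1_def D2_def F_flow F1_flow[OF assms] F2_flow[OF assms])

lemma D_derivative:
  assumes e: "e > 0" and \<omega>: "\<omega> \<in> space torus_haar" and s: "Re (z + of_real x * d) > 0"
  shows "((\<lambda>x. psi e ((cmod (F \<omega> (z + of_real x * d)))\<^sup>2)) has_real_derivative D1 e d \<omega> (z + of_real x * d)) (at x within A)"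
    and "((\<lambda>x. D1 e d \<omega> (z + of_real x * d)) has_real_derivative D2 e d \<omega> (z + of_real x * d)) (at x within A)"
  unfolding D1_def D2_def using psi_along_curve[OF e F_vector_derivs(1,2)[OF \<omega> s]] by auto

lemma D_continuous:
  assumes e: "e > 0" and \<omega>: "\<omega> \<in> space torus_haar" and s: "\<And>x. x \<in> A \<Longrightarrow> Re (z + of_real x * d) > 0"
  shows "continuous_on A (\<lambda>x. D2 e d \<omega> (z + of_real x * d))"
proof -
  have img: "(\<lambda>x. z + of_real x * d) ` A \<subseteq> right_half_plane 0"
    using s by (auto simp: right_half_plane_def)
  have line: "continuous_on A (\<lambda>x. z + of_real x * d)" by (intro continuous_intros)
  note [continuous_intros] = continuous_on_compose2[OF F_jet_continuous(1)[OF \<omega>] line img]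
    continuous_on_compose2[OF F_jet_continuous(2)[OF \<omega>] line img]
    continuous_on_compose2[OF F_jet_continuous(3)[OF \<omega>] line img]
  have pos: "e\<^sup>2 + y\<^sup>2 > 0" for y :: real using e by (simp add: add_pos_nonneg)
  have pos': "1 + sqrt (e\<^sup>2 + y\<^sup>2) > 0" for y :: real using e by (simp add: add_pos_nonneg)
  show ?thesis
    unfolding D2_def dpsi2_def psi1_def psi2_def Let_def
    by (intro continuous_intros) (use pos pos' in \<open>auto simp: less_imp_neq[THEN not_sym]\<close>)
qed

lemma D_bounded:
  assumes "\<theta> > 0" "e > 0" "cmod d = 1"
  obtains K where "K > 0" "\<And>\<omega> s. \<omega> \<in> space torus_haar \<Longrightarrow> Re s \<ge> \<theta> \<Longrightarrow>
    \<bar>D1 e d \<omega> s\<bar> \<le> K * cmod (F1 \<omega> s)"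
    "\<And>\<omega> s. \<omega> \<in> space torus_haar \<Longrightarrow> Re s \<ge> \<theta> \<Longrightarrow> \<bar>D1 e d \<omega> s\<bar> \<le> K"
    "\<And>\<omega> s. \<omega> \<in> space torus_haar \<Longrightarrow> Re s \<ge> \<theta> \<Longrightarrow> \<bar>D2 e d \<omega> s\<bar> \<le> K"
proof -
  obtain K where K: "K > 0" "\<And>\<omega> s. \<omega> \<in> space torus_haar \<Longrightarrow> Re s \<ge> \<theta> \<Longrightarrow>
    cmod (F \<omega> s) \<le> K \<and> cmod (F1 \<omega> s) \<le> K \<and> cmod (F2 \<omega> s) \<le> K"
    using F_jet_bounded[OF assms(1)] by blast
  define K1 where "K1 = K / e"
  define K2 where "K2 = (1 / (2 * e ^ 3)) * (2 * (K * K))\<^sup>2 + (1 / (2 * e)) * (2 * (K\<^sup>2 + K * K))"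
  have pos: "K1 > 0" "K1 * K > 0" "K2 > 0"
    using K(1) assms by (auto simp: K1_def K2_def intro!: add_pos_pos mult_pos_pos divide_pos_pos)
  have b: "\<bar>D1 e d \<omega> s\<bar> \<le> K1 * cmod (F1 \<omega> s)" "\<bar>D2 e d \<omega> s\<bar> \<le> K2" "cmod (F1 \<omega> s) \<le> K"
    if \<omega>: "\<omega> \<in> space torus_haar" and s: "Re s \<ge> \<theta>" for \<omega> s
  proof -
    show "\<bar>D1 e d \<omega> s\<bar> \<le> K1 * cmod (F1 \<omega> s)"
      unfolding D1_def K1_def using dpsi1_bound[of e "F \<omega> s" K "d * F1 \<omega> s"] K(2)[OF \<omega> s] assms
      by (simp add: norm_mult)
    show "\<bar>D2 e d \<omega> s\<bar> \<le> K2"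
      unfolding D2_def K2_def using K(2)[OF \<omega> s] assms
      by (intro dpsi2_bound) (auto simp: norm_mult norm_power)
    show "cmod (F1 \<omega> s) \<le> K" using K(2)[OF \<omega> s] by simp
  qed
  show ?thesis
  proof (rule that[of "K1 + K1 * K + K2"])
    fix \<omega> s assume \<omega>: "\<omega> \<in> space torus_haar" and s: "Re s \<ge> \<theta>"
    note b = b[OF \<omega> s]
    have "K1 * cmod (F1 \<omega> s) \<le> (K1 + K1 * K + K2) * cmod (F1 \<omega> s)"
      using pos by (intro mult_right_mono) auto
    then show "\<bar>D1 e d \<omega> s\<bar> \<le> (K1 + K1 * K + K2) * cmod (F1 \<omega> s)" using b by linarith
    have "K1 * cmod (F1 \<omega> s) \<le> K1 * K" using pos b by (intro mult_left_mono) auto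
    then show "\<bar>D1 e d \<omega> s\<bar> \<le> K1 + K1 * K + K2" using b pos by linarith
    show "\<bar>D2 e d \<omega> s\<bar> \<le> K1 + K1 * K + K2" using b pos by linarith
  qed (use pos in auto)
qed

text \<open>The integral does not change under vertical translation. Hence it equals its own average over a vertical
segment of length \<open>1\<close>, which is the torus integral of the difference of \<open>D1\<close> at the two ends, and that
difference integrates to \<open>0\<close> by invariance.\<close>

lemma integral_D2_vertical:
  assumes e: "e > 0" and \<sigma>: "\<sigma> > 0"
  shows "(\<integral>\<omega>. D2 e \<i> \<omega> (of_real \<sigma>) \<partial>torus_haar) = 0"
proof -
  obtain K where K: "K > 0" "\<And>\<omega> s. \<omega> \<in> space torus_haar \<Longrightarrow> Re s \<ge> \<sigma> \<Longrightarrow> \<bar>D1 e \<i> \<omega> s\<bar> \<le> K"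
    "\<And>\<omega> s. \<omega> \<in> space torus_haar \<Longrightarrow> Re s \<ge> \<sigma> \<Longrightarrow> \<bar>D2 e \<i> \<omega> s\<bar> \<le> K"
    using D_bounded[OF \<sigma> e, of \<i>] by (metis norm_ii)
  have int1: "integrable torus_haar (\<lambda>\<omega>. D1 e \<i> \<omega> s)" if "Re s \<ge> \<sigma>" for s
    using K that by (intro torus.integrable_const_bound[where B = K] AE_I2) auto
  have shift: "(\<integral>\<omega>. D2 e \<i> \<omega> (of_real \<sigma> + of_real t * \<i>) \<partial>torus_haar) = (\<integral>\<omega>. D2 e \<i> \<omega> (of_real \<sigma>) \<partial>torus_haar)" for t
    by (subst integral_flow[of "\<lambda>\<omega>. D2 e \<i> \<omega> (of_real \<sigma>)" t, symmetric])
       (auto intro!: Bochner_Integration.integral_cong simp: D_flow mult.commute)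
  have shift1: "(\<integral>\<omega>. D1 e \<i> \<omega> (of_real \<sigma> + \<i>) \<partial>torus_haar) = (\<integral>\<omega>. D1 e \<i> \<omega> (of_real \<sigma>) \<partial>torus_haar)"
    by (subst integral_flow[of "\<lambda>\<omega>. D1 e \<i> \<omega> (of_real \<sigma>)" 1, symmetric])
       (auto intro!: Bochner_Integration.integral_cong simp: D_flow)
  have "(\<integral>\<omega>. D2 e \<i> \<omega> (of_real \<sigma>) \<partial>torus_haar)
      = (LBINT t:{0..1}. (\<integral>\<omega>. D2 e \<i> \<omega> (of_real \<sigma> + of_real t * \<i>) \<partial>torus_haar))"
    unfolding shift by (simp add: set_lebesgue_integral_def)
  also have "\<dots> = (\<integral>\<omega>. (LBINT t:{0..1}. D2 e \<i> \<omega> (of_real \<sigma> + of_real t * \<i>)) \<partial>torus_haar)"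
    by (intro integral_torus_strip[symmetric, where K = K] K) auto
  also have "\<dots> = (\<integral>\<omega>. D1 e \<i> \<omega> (of_real \<sigma> + \<i>) - D1 e \<i> \<omega> (of_real \<sigma>) \<partial>torus_haar)"
  proof (rule Bochner_Integration.integral_cong)
    fix \<omega> assume \<omega>: "\<omega> \<in> space torus_haar"
    have "(LBINT t:{0..1}. D2 e \<i> \<omega> (of_real \<sigma> + of_real t * \<i>))
      = D1 e \<i> \<omega> (of_real \<sigma> + of_real 1 * \<i>) - D1 e \<i> \<omega> (of_real \<sigma> + of_real 0 * \<i>)"
      unfolding set_lebesgue_integral_def
      by (rule integral_FTC_atLeastAtMost)
         (use \<sigma> in \<open>auto intro!: D_continuous[OF e \<omega>] D_derivative(2)[OF e \<omega>]
            simp: has_real_derivative_iff_has_vector_derivative[symmetric]\<close>)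
    then show "(LBINT t:{0..1}. D2 e \<i> \<omega> (of_real \<sigma> + of_real t * \<i>))
      = D1 e \<i> \<omega> (of_real \<sigma> + \<i>) - D1 e \<i> \<omega> (of_real \<sigma>)" by simp
  qed simp
  also have "\<dots> = 0"
    using shift1 by (subst Bochner_Integration.integral_diff) (auto intro!: int1)
  finally show ?thesis .
qed

definition regular_mean :: "real \<Rightarrow> real \<Rightarrow> real" where
  "regular_mean e \<sigma> = (\<integral>\<omega>. psi e ((cmod (F \<omega> (of_real \<sigma>)))\<^sup>2) \<partial>torus_haar)"

definition regular_slope :: "real \<Rightarrow> real \<Rightarrow> real" where
  "regular_slope e \<sigma> = (\<integral>\<omega>. D1 e 1 \<omega> (of_real \<sigma>) \<partial>torus_haar)"

definition density :: "real \<Rightarrow> (nat \<Rightarrow> complex) \<Rightarrow> real \<Rightarrow> real" where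
  "density e \<omega> x = lap e ((cmod (F \<omega> (of_real x)))\<^sup>2) * (cmod (F1 \<omega> (of_real x)))\<^sup>2"

lemma measurable_density [measurable (raw)]:
  assumes [measurable]: "w \<in> M \<rightarrow>\<^sub>M torus_haar" "s \<in> borel_measurable M"
  shows "(\<lambda>x. density e (w x) (s x)) \<in> borel_measurable M"
  unfolding density_def by measurable

lemma density_eq: "density e \<omega> x = D2 e 1 \<omega> (of_real x) + D2 e \<i> \<omega> (of_real x)"
  unfolding density_def D2_def using dpsi_laplacian[of e "F \<omega> (of_real x)" "F1 \<omega> (of_real x)" "F2 \<omega> (of_real x)"]
  by simp

lemma psi_bounded:
  assumes e: "e > 0" and w: "cmod w \<le> K"
  shows "\<bar>psi e ((cmod w)\<^sup>2)\<bar> \<le> K + e"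
proof -
  have "ln (1 + cmod w) \<le> cmod w" by (rule ln_add_one_self_le_self) simp
  moreover have "ln (1 + cmod w) \<ge> 0" by simp
  ultimately show ?thesis using psi_approx[OF e, of w] w by linarith
qed

text \<open>For fixed \<open>\<omega>\<close>, with \<open>u\<close> the restriction of \<open>psi e (|f\<^sub>\<omega>|\<^sup>2)\<close> to the real axis, the function
\<open>(x - c) u'(x) - u(x)\<close> is a primitive of \<open>(x - c) u''(x)\<close>. After integration over \<open>\<omega>\<close>, the second derivative
\<open>u''\<close> may be replaced by the Laplacian.\<close>

lemma regular_mean_taylor:
  assumes e: "e > 0" and c: "c > 0" and b: "c \<le> b"
  shows "integrable (torus_haar \<Otimes>\<^sub>M lborel) (\<lambda>(\<omega>, x). indicator {c..b} x * ((x - c) * density e \<omega> x))"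
    and "(\<integral>p. (case p of (\<omega>, x) \<Rightarrow> indicator {c..b} x * ((x - c) * density e \<omega> x)) \<partial>(torus_haar \<Otimes>\<^sub>M lborel))
      = (b - c) * regular_slope e b - regular_mean e b + regular_mean e c"
proof -
  obtain K1 where K1: "K1 > 0" "\<And>\<omega> s. \<omega> \<in> space torus_haar \<Longrightarrow> Re s \<ge> c \<Longrightarrow> \<bar>D1 e 1 \<omega> s\<bar> \<le> K1"
    "\<And>\<omega> s. \<omega> \<in> space torus_haar \<Longrightarrow> Re s \<ge> c \<Longrightarrow> \<bar>D2 e 1 \<omega> s\<bar> \<le> K1"
    using D_bounded[OF c e, of 1] by (metis norm_one)
  obtain K2 where K2: "\<And>\<omega> s. \<omega> \<in> space torus_haar \<Longrightarrow> Re s \<ge> c \<Longrightarrow> \<bar>D2 e \<i> \<omega> s\<bar> \<le> K2"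
    using D_bounded[OF c e, of \<i>] by (metis norm_ii)
  obtain K where K: "\<And>\<omega> s. \<omega> \<in> space torus_haar \<Longrightarrow> Re s \<ge> c \<Longrightarrow> cmod (F \<omega> s) \<le> K"
    using F_jet_bounded[OF c] by metis
  have weight: "\<bar>(x - c) * y\<bar> \<le> (b - c) * L" if "x \<in> {c..b}" "\<bar>y\<bar> \<le> L" for x y L
    using that unfolding abs_mult by (intro mult_mono) auto
  have dens: "\<bar>density e \<omega> x\<bar> \<le> K1 + K2" if "\<omega> \<in> space torus_haar" "x \<in> {c..b}" for \<omega> x
    using K1(3)[OF that(1), of "of_real x"] K2[OF that(1), of "of_real x"] that
    unfolding density_eq by (auto intro: order_trans[OF abs_triangle_ineq])
  show int: "integrable (torus_haar \<Otimes>\<^sub>M lborel) (\<lambda>(\<omega>, x). indicator {c..b} x * ((x - c) * density e \<omega> x))"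
    by (rule integrable_torus_strip[where K = "(b - c) * (K1 + K2)"]) (auto intro!: weight dens)
  have "(\<integral>p. (case p of (\<omega>, x) \<Rightarrow> indicator {c..b} x * ((x - c) * density e \<omega> x)) \<partial>(torus_haar \<Otimes>\<^sub>M lborel))
     = (LBINT x:{c..b}. (\<integral>\<omega>. (x - c) * density e \<omega> x \<partial>torus_haar))"
    using torus_line.integral_snd[OF int] by (simp add: set_lebesgue_integral_def)
  also have "\<dots> = (LBINT x:{c..b}. (\<integral>\<omega>. (x - c) * D2 e 1 \<omega> (of_real x) \<partial>torus_haar))"
  proof (intro set_lebesgue_integral_cong ballI allI impI)
    fix x assume x: "x \<in> {c..b}"
    have "(\<integral>\<omega>. density e \<omega> x \<partial>torus_haar)
       = (\<integral>\<omega>. D2 e 1 \<omega> (of_real x) \<partial>torus_haar) + (\<integral>\<omega>. D2 e \<i> \<omega> (of_real x) \<partial>torus_haar)"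
      unfolding density_eq
    proof (rule Bochner_Integration.integral_add)
      show "integrable torus_haar (\<lambda>\<omega>. D2 e 1 \<omega> (of_real x))"
        using K1 x by (intro torus.integrable_const_bound[where B = K1] AE_I2) auto
      show "integrable torus_haar (\<lambda>\<omega>. D2 e \<i> \<omega> (of_real x))"
        using K2 x by (intro torus.integrable_const_bound[where B = K2] AE_I2) auto
    qed
    then show "(\<integral>\<omega>. (x - c) * density e \<omega> x \<partial>torus_haar) = (\<integral>\<omega>. (x - c) * D2 e 1 \<omega> (of_real x) \<partial>torus_haar)"
      using integral_D2_vertical[OF e, of x] x c by simp
  qed simp
  also have "\<dots> = (\<integral>\<omega>. (LBINT x:{c..b}. (x - c) * D2 e 1 \<omega> (of_real x)) \<partial>torus_haar)"
    by (rule integral_torus_strip[symmetric, where K = "(b - c) * K1"]) (auto intro!: weight K1)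
  also have "\<dots> = (\<integral>\<omega>. (b - c) * D1 e 1 \<omega> (of_real b) - psi e ((cmod (F \<omega> (of_real b)))\<^sup>2)
      + psi e ((cmod (F \<omega> (of_real c)))\<^sup>2) \<partial>torus_haar)"
  proof (rule Bochner_Integration.integral_cong)
    fix \<omega> assume \<omega>: "\<omega> \<in> space torus_haar"
    \<comment> \<open>The real axis is written as \<open>0 + of_real x * 1\<close> to fit the lemmas on lines \<open>z + of_real x * d\<close>.\<close>
    define G where "G x = (x - c) * D1 e 1 \<omega> (0 + of_real x * 1) - psi e ((cmod (F \<omega> (0 + of_real x * 1)))\<^sup>2)" for x
    have "(LBINT x:{c..b}. (x - c) * D2 e 1 \<omega> (0 + of_real x * 1)) = G b - G c"
      unfolding set_lebesgue_integral_def
    proof (rule integral_FTC_atLeastAtMost[OF b])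
      fix x assume x: "c \<le> x" "x \<le> b"
      then have re: "Re (0 + of_real x * 1) > 0" using c by simp
      have "(G has_real_derivative ((x - c) * D2 e 1 \<omega> (0 + of_real x * 1))) (at x within {c..b})"
        unfolding G_def
        by (rule derivative_eq_intros refl D_derivative[OF e \<omega> re])+ (simp add: algebra_simps)
      then show "(G has_vector_derivative ((x - c) * D2 e 1 \<omega> (0 + of_real x * 1))) (at x within {c..b})"
        by (simp add: has_real_derivative_iff_has_vector_derivative)
    next
      show "continuous_on {c..b} (\<lambda>x. (x - c) * D2 e 1 \<omega> (0 + of_real x * 1))"
        using c by (intro continuous_on_mult D_continuous[OF e \<omega>] continuous_intros) auto
    qed
    then show "(LBINT x:{c..b}. (x - c) * D2 e 1 \<omega> (of_real x)) =
      (b - c) * D1 e 1 \<omega> (of_real b) - psi e ((cmod (F \<omega> (of_real b)))\<^sup>2) + psi e ((cmod (F \<omega> (of_real c)))\<^sup>2)"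
      by (simp add: G_def)
  qed simp
  also have "\<dots> = (b - c) * regular_slope e b - regular_mean e b + regular_mean e c"
  proof -
    have i1: "integrable torus_haar (\<lambda>\<omega>. D1 e 1 \<omega> (of_real b))"
      using K1 b by (intro torus.integrable_const_bound[where B = K1] AE_I2) auto
    have i2: "integrable torus_haar (\<lambda>\<omega>. psi e ((cmod (F \<omega> (of_real x)))\<^sup>2))" if "x \<ge> c" for x
      using K that by (intro torus.integrable_const_bound[where B = "K + e"] AE_I2)
        (auto intro!: psi_bounded[OF e])
    show ?thesis
      unfolding regular_slope_def regular_mean_def using i1 i2[OF b] i2[of c] by simp
  qed
  finally show "(\<integral>p. (case p of (\<omega>, x) \<Rightarrow> indicator {c..b} x * ((x - c) * density e \<omega> x)) \<partial>(torus_haar \<Otimes>\<^sub>M lborel))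
      = (b - c) * regular_slope e b - regular_mean e b + regular_mean e c" .
qed

lemma F_tendsto_at_infinity:
  assumes \<omega>: "\<omega> \<in> space torus_haar"
  shows "((\<lambda>\<sigma>::real. F \<omega> (of_real \<sigma>)) \<longlongrightarrow> a 1) at_top"
proof (rule tendstoI)
  fix r :: real assume "r > 0"
  from F_at_infinity[OF this]
  obtain R where R: "\<And>\<omega> s. \<omega> \<in> space torus_haar \<Longrightarrow> Re s > R \<Longrightarrow> cmod (F \<omega> s - a 1) < r"
    by metis
  show "\<forall>\<^sub>F \<sigma> in at_top. dist (F \<omega> (of_real \<sigma>)) (a 1) < r"
    using eventually_gt_at_top[of R] by eventually_elim (use \<omega> R in \<open>auto simp: dist_norm\<close>)
qed

lemma dseries_at_infinity_twist:
  "\<omega> \<in> space torus_haar \<Longrightarrow> dseries_at_infinity (twist a \<omega>) = a 1"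
  unfolding dseries_at_infinity_def
  by (rule tendsto_Lim[OF trivial_limit_at_top_linorder F_tendsto_at_infinity])

lemma regular_mean_at_infinity:
  assumes e: "e > 0"
  shows "(regular_mean e \<longlongrightarrow> psi e ((cmod (a 1))\<^sup>2)) at_top"
proof -
  obtain K where K: "\<And>\<omega> s. \<omega> \<in> space torus_haar \<Longrightarrow> Re s \<ge> 1 \<Longrightarrow> cmod (F \<omega> s) \<le> K"
    using F_jet_bounded[of 1] by (metis zero_less_one)
  have "((\<lambda>\<sigma>. \<integral>\<omega>. psi e ((cmod (F \<omega> (of_real \<sigma>)))\<^sup>2) \<partial>torus_haar)
       \<longlongrightarrow> (\<integral>\<omega>. psi e ((cmod (a 1))\<^sup>2) \<partial>torus_haar)) at_top"
  proof (rule integral_dominated_convergence_at_top[where w = "\<lambda>_. K + e"])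
    show "\<forall>\<^sub>F \<sigma> in at_top. AE \<omega> in torus_haar. norm (psi e ((cmod (F \<omega> (of_real \<sigma>)))\<^sup>2)) \<le> K + e"
      using eventually_ge_at_top[of 1]
      by eventually_elim (use K in \<open>auto intro!: AE_I2 psi_bounded[OF e]\<close>)
    show "AE \<omega> in torus_haar. ((\<lambda>\<sigma>. psi e ((cmod (F \<omega> (of_real \<sigma>)))\<^sup>2)) \<longlongrightarrow> psi e ((cmod (a 1))\<^sup>2)) at_top"
    proof (rule AE_I2)
      fix \<omega> assume \<omega>: "\<omega> \<in> space torus_haar"
      from F_tendsto_at_infinity[OF \<omega>]
      have "((\<lambda>\<sigma>::real. (cmod (F \<omega> (of_real \<sigma>)))\<^sup>2) \<longlongrightarrow> (cmod (a 1))\<^sup>2) at_top"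
        by (intro tendsto_intros)
      moreover have "isCont (psi e) ((cmod (a 1))\<^sup>2)"
        using psi_derivs(1)[OF e, of "(cmod (a 1))\<^sup>2"] DERIV_isCont by auto
      ultimately show "((\<lambda>\<sigma>. psi e ((cmod (F \<omega> (of_real \<sigma>)))\<^sup>2)) \<longlongrightarrow> psi e ((cmod (a 1))\<^sup>2)) at_top"
        by (rule isCont_tendsto_compose[rotated])
    qed
  qed auto
  then show ?thesis
    by (simp add: regular_mean_def[abs_def] torus.prob_space)
qed

lemma regular_slope_decay:
  assumes e: "e > 0"
  shows "((\<lambda>b. (b - x) * regular_slope e b) \<longlongrightarrow> 0) at_top"
proof (rule tendstoI)
  fix r :: real assume r: "r > 0"
  obtain K where K: "K > 0" "\<And>\<omega> s. \<omega> \<in> space torus_haar \<Longrightarrow> Re s \<ge> 1 \<Longrightarrow>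
    \<bar>D1 e 1 \<omega> s\<bar> \<le> K * cmod (F1 \<omega> s)" 
    using D_bounded[OF _ e, of 1 1] by (metis norm_one zero_less_one)
  have "r / (4 * K) > 0" using r K by simp
  then obtain R where R: "R > 0" "\<And>\<omega> s. \<omega> \<in> space torus_haar \<Longrightarrow> Re s > R \<Longrightarrow> Re s * cmod (deriv (F \<omega>) s) \<le> r / (4 * K)"
    using F_deriv_decay by blast
  have "\<bar>(b - x) * regular_slope e b\<bar> < r" if b: "b > max 1 (max R \<bar>x\<bar>)" for b
  proof -
    have pt: "\<bar>D1 e 1 \<omega> (of_real b)\<bar> \<le> r / (4 * b)" if \<omega>: "\<omega> \<in> space torus_haar" for \<omega>
    proof -
      have "\<bar>D1 e 1 \<omega> (of_real b)\<bar> \<le> K * cmod (F1 \<omega> (of_real b))" using b by (intro K(2) \<omega>) auto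
      also have "\<dots> \<le> K * (r / (4 * K) / b)"
        using R(2)[OF \<omega>, of "of_real b"] b K r
        by (intro mult_left_mono) (auto simp: F1_def field_simps)
      also have "\<dots> = r / (4 * b)" using K by simp
      finally show ?thesis .
    qed
    have "\<bar>regular_slope e b\<bar> \<le> (\<integral>\<omega>. \<bar>D1 e 1 \<omega> (of_real b)\<bar> \<partial>torus_haar)"
      unfolding regular_slope_def by (rule integral_abs_bound)
    also have "\<dots> \<le> (\<integral>\<omega>. r / (4 * b) \<partial>torus_haar)"
      using pt b r by (intro integral_mono torus.integrable_const_bound[where B = "r / (4 * b)"] AE_I2) auto
    also have "\<dots> = r / (4 * b)" by (simp add: torus.prob_space)
    finally have "\<bar>regular_slope e b\<bar> \<le> r / (4 * b)" .
    then have "\<bar>b - x\<bar> * \<bar>regular_slope e b\<bar> \<le> (2 * b) * (r / (4 * b))"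
      using b by (intro mult_mono) auto
    also have "\<dots> = r / 2" using b by (simp add: field_simps)
    also have "\<dots> < r" using r by simp
    finally show ?thesis by (simp only: abs_mult)
  qed
  then show "\<forall>\<^sub>F b in at_top. dist ((b - x) * regular_slope e b) 0 < r"
    using eventually_gt_at_top[of "max 1 (max R \<bar>x\<bar>)"] by (auto elim: eventually_mono)
qed

end

section \<open>The Littlewood--Paley identity\<close>

context unif_dirichlet
begin

lemma density_nonneg: "e > 0 \<Longrightarrow> density e \<omega> x \<ge> 0"
  by (simp add: density_def lap_nonneg)

text \<open>The Taylor formula on \<open>[c, b]\<close> as \<open>b\<close> tends to infinity.\<close>

lemma regular_mean_identity:
  assumes e: "e > 0" and c: "c > 0"
  shows "(\<integral>\<^sup>+ p. (case p of (\<omega>, x) \<Rightarrow> ennreal (max 0 (x - c) * density e \<omega> x)) \<partial>(torus_haar \<Otimes>\<^sub>M lborel))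
      = ennreal (regular_mean e c - psi e ((cmod (a 1))\<^sup>2))"
    and "psi e ((cmod (a 1))\<^sup>2) \<le> regular_mean e c"
proof -
  define r where "r b = (b - c) * regular_slope e b - regular_mean e b + regular_mean e c" for b
  define u where "u n = (\<lambda>(\<omega>, x). indicator {c..c + real n} x * ((x - c) * density e \<omega> x))" for n :: nat
  have u_nonneg: "0 \<le> u n p" for n p
    using density_nonneg[OF e] by (auto simp: u_def indicator_def split: prod.splits)
  have u_int: "(\<integral>\<^sup>+ p. ennreal (u n p) \<partial>(torus_haar \<Otimes>\<^sub>M lborel)) = ennreal (r (c + real n))"
    and r_nonneg: "0 \<le> r (c + real n)" for n
  proof -
    have le: "c \<le> c + real n" by simp
    note T = regular_mean_taylor[OF e c le, folded u_def r_def]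
    show "(\<integral>\<^sup>+ p. ennreal (u n p) \<partial>(torus_haar \<Otimes>\<^sub>M lborel)) = ennreal (r (c + real n))"
      using nn_integral_eq_integral[OF T(1)] u_nonneg T(2) by simp
    show "0 \<le> r (c + real n)"
      using T(2) Bochner_Integration.integral_nonneg[of "torus_haar \<Otimes>\<^sub>M lborel" "u n", OF u_nonneg] by simp
  qed
  have "(r \<longlongrightarrow> 0 - psi e ((cmod (a 1))\<^sup>2) + regular_mean e c) at_top"
    unfolding r_def[abs_def]
    by (intro tendsto_intros regular_slope_decay regular_mean_at_infinity e)
  moreover have "filterlim (\<lambda>n. c + real n) at_top sequentially"
    by (rule filterlim_tendsto_add_at_top[OF tendsto_const filterlim_real_sequentially])
  ultimately have r_lim: "(\<lambda>n. r (c + real n)) \<longlonglongrightarrow> regular_mean e c - psi e ((cmod (a 1))\<^sup>2)"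
    using filterlim_compose[of r _ at_top "\<lambda>n. c + real n" sequentially] by simp
  show "psi e ((cmod (a 1))\<^sup>2) \<le> regular_mean e c"
    using LIMSEQ_le_const[OF r_lim, of 0] r_nonneg by auto
  have "(\<lambda>n. \<integral>\<^sup>+ p. ennreal (u n p) \<partial>(torus_haar \<Otimes>\<^sub>M lborel)) \<longlonglongrightarrow>
     (\<integral>\<^sup>+ p. (case p of (\<omega>, x) \<Rightarrow> ennreal (max 0 (x - c) * density e \<omega> x)) \<partial>(torus_haar \<Otimes>\<^sub>M lborel))"
  proof (rule nn_integral_LIMSEQ)
    show "incseq (\<lambda>n p. ennreal (u n p))"
      using density_nonneg[OF e]
      by (auto simp: incseq_def le_fun_def u_def indicator_def intro!: ennreal_leI)
    show "(\<lambda>p. ennreal (u n p)) \<in> borel_measurable (torus_haar \<Otimes>\<^sub>M lborel)" for n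
      unfolding u_def by measurable
    show "(\<lambda>n. ennreal (u n p)) \<longlonglongrightarrow> (case p of (\<omega>, x) \<Rightarrow> ennreal (max 0 (x - c) * density e \<omega> x))" for p
    proof (rule tendsto_eventually)
      obtain \<omega> x where p: "p = (\<omega>, x)" by (cases p)
      show "\<forall>\<^sub>F n in sequentially. ennreal (u n p) = (case p of (\<omega>, x) \<Rightarrow> ennreal (max 0 (x - c) * density e \<omega> x))"
        using eventually_ge_at_top[of "nat \<lceil>x - c\<rceil>"]
      proof eventually_elim
        case (elim n)
        then have "x \<le> c + real n" by linarith
        then show ?case by (auto simp: u_def p indicator_def)
      qed
    qed
  qed
  moreover have "(\<lambda>n. \<integral>\<^sup>+ p. ennreal (u n p) \<partial>(torus_haar \<Otimes>\<^sub>M lborel))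
      \<longlonglongrightarrow> ennreal (regular_mean e c - psi e ((cmod (a 1))\<^sup>2))"
    unfolding u_int by (rule tendsto_ennrealI[OF r_lim])
  ultimately show "(\<integral>\<^sup>+ p. (case p of (\<omega>, x) \<Rightarrow> ennreal (max 0 (x - c) * density e \<omega> x)) \<partial>(torus_haar \<Otimes>\<^sub>M lborel))
      = ennreal (regular_mean e c - psi e ((cmod (a 1))\<^sup>2))"
    by (rule LIMSEQ_unique)
qed

definition log_mean :: "real \<Rightarrow> real" where
  "log_mean \<sigma> = (\<integral>\<omega>. ln (1 + cmod (F \<omega> (of_real \<sigma>))) \<partial>torus_haar)"

definition kernel :: "(nat \<Rightarrow> complex) \<Rightarrow> complex \<Rightarrow> real" where
  "kernel \<omega> s = area_kernel (F \<omega> s) (F1 \<omega> s)"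

lemma measurable_kernel [measurable (raw)]:
  assumes [measurable]: "w \<in> M \<rightarrow>\<^sub>M torus_haar" "s \<in> borel_measurable M"
  shows "(\<lambda>x. kernel (w x) (s x)) \<in> borel_measurable M"
  unfolding kernel_def by measurable

lemma kernel_nonneg: "kernel \<omega> s \<ge> 0"
  by (simp add: kernel_def area_kernel_def)

lemma regular_mean_approx:
  assumes e: "e > 0" and c: "c > 0"
  shows "\<bar>regular_mean e c - log_mean c\<bar> \<le> e"
proof -
  obtain K where K: "\<And>\<omega> s. \<omega> \<in> space torus_haar \<Longrightarrow> Re s \<ge> c \<Longrightarrow> cmod (F \<omega> s) \<le> K"
    using F_jet_bounded[OF c] by metis
  have i1: "integrable torus_haar (\<lambda>\<omega>. psi e ((cmod (F \<omega> (of_real c)))\<^sup>2))"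
    using K by (intro torus.integrable_const_bound[where B = "K + e"] AE_I2)
      (auto intro!: psi_bounded[OF e])
  have i2: "integrable torus_haar (\<lambda>\<omega>. ln (1 + cmod (F \<omega> (of_real c))))"
  proof (intro torus.integrable_const_bound[where B = K] AE_I2)
    fix \<omega> assume "\<omega> \<in> space torus_haar"
    then have "cmod (F \<omega> (of_real c)) \<le> K" by (intro K) auto
    then show "norm (ln (1 + cmod (F \<omega> (of_real c)))) \<le> K"
      using ln_add_one_self_le_self[of "cmod (F \<omega> (of_real c))"] by simp
  qed measurable
  have "\<bar>regular_mean e c - log_mean c\<bar>
      = \<bar>\<integral>\<omega>. psi e ((cmod (F \<omega> (of_real c)))\<^sup>2) - ln (1 + cmod (F \<omega> (of_real c))) \<partial>torus_haar\<bar>"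
    using i1 i2 by (simp add: regular_mean_def log_mean_def)
  also have "\<dots> \<le> (\<integral>\<omega>. \<bar>psi e ((cmod (F \<omega> (of_real c)))\<^sup>2) - ln (1 + cmod (F \<omega> (of_real c)))\<bar> \<partial>torus_haar)"
    by (rule integral_abs_bound)
  also have "\<dots> \<le> (\<integral>\<omega>. e \<partial>torus_haar)"
    using i1 i2 by (intro integral_mono integrable_abs Bochner_Integration.integrable_diff psi_approx e) auto
  also have "\<dots> = e" by (simp add: torus.prob_space)
  finally show ?thesis .
qed

text \<open>For fixed \<open>\<omega>\<close> the function \<open>f\<^sub>\<omega>\<close> is either constant, so that its derivative vanishes, or has countably many
zeros. So for almost all \<open>(\<omega>, x)\<close> with \<open>f\<^sub>\<omega>(x) = 0\<close> the densities \<open>density e\<close> vanish, like the kernel.\<close>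

lemma AE_zeros_degenerate:
  "AE p in torus_haar \<Otimes>\<^sub>M lborel. case p of (\<omega>, x) \<Rightarrow>
     x > 0 \<longrightarrow> F \<omega> (of_real x) = 0 \<longrightarrow> F1 \<omega> (of_real x) = 0"
proof (rule torus_line.AE_pair_measure)
  show "{p \<in> space (torus_haar \<Otimes>\<^sub>M lborel). case p of (\<omega>, x) \<Rightarrow>
     x > 0 \<longrightarrow> F \<omega> (of_real x) = 0 \<longrightarrow> F1 \<omega> (of_real x) = 0} \<in> sets (torus_haar \<Otimes>\<^sub>M lborel)"
    by measurable
  show "AE \<omega> in torus_haar. AE x in lborel. case (\<omega>, x) of (\<omega>, x) \<Rightarrow>
     x > 0 \<longrightarrow> F \<omega> (of_real x) = 0 \<longrightarrow> F1 \<omega> (of_real x) = 0"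
  proof (rule AE_I2)
    fix \<omega> assume \<omega>: "\<omega> \<in> space torus_haar"
    let ?H = "right_half_plane 0"
    have o: "open ?H" unfolding right_half_plane_def by (rule open_halfspace_Re_gt)
    have "countable {x::real. x > 0 \<and> F \<omega> (of_real x) = 0 \<and> F1 \<omega> (of_real x) \<noteq> 0}"
    proof (cases "F \<omega> constant_on ?H")
      case True
      then obtain y where y: "\<And>z. z \<in> ?H \<Longrightarrow> F \<omega> z = y" unfolding constant_on_def by blast
      have "F1 \<omega> (of_real x) = 0" if "x > 0" for x :: real
      proof -
        have "((\<lambda>_. y) has_field_derivative F1 \<omega> (of_real x)) (at (of_real x))"
          by (rule has_field_derivative_transform_within_open[OF F_has_derivative(1)[OF \<omega>] o])
             (use that y in \<open>auto simp: right_half_plane_def\<close>)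
        then show ?thesis by (rule DERIV_unique) simp
      qed
      then have "{x::real. x > 0 \<and> F \<omega> (of_real x) = 0 \<and> F1 \<omega> (of_real x) \<noteq> 0} = {}" by auto
      then show ?thesis by (metis countable_empty)
    next
      case False
      have "connected ?H"
        unfolding right_half_plane_def by (intro convex_connected convex_halfspace_Re_gt)
      moreover have "fsigma ?H"
      proof -
        have "\<exists>n. inverse (real (Suc n)) \<le> Re z" if "Re z > 0" for z
          using reals_Archimedean[OF that] less_imp_le by blast
        moreover have "Re z > 0" if "inverse (real (Suc n)) \<le> Re z" for z n
          using that by (rule less_le_trans[rotated]) simp
        ultimately have "?H = (\<Union>n. {z. inverse (real (Suc n)) \<le> Re z})"
          unfolding right_half_plane_def by blast
        moreover have "fsigma (\<Union>n. {z. inverse (real (Suc n)) \<le> Re z})"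
          by (intro fsigma.intros closed_Collect_le continuous_intros)
        ultimately show ?thesis by simp
      qed
      ultimately have "countable {z \<in> ?H. F \<omega> z = 0}"
        using F_holomorphic[OF \<omega>] o False by (intro holomorphic_countable_zeros)
      then have "countable {x. complex_of_real x \<in> {z \<in> ?H. F \<omega> z = 0}}"
        using countable_image_inj_Int_vimage[of complex_of_real UNIV "{z \<in> ?H. F \<omega> z = 0}"]
        by (simp add: inj_of_real vimage_def)
      then show ?thesis
        by (rule countable_subset[rotated]) (auto simp: right_half_plane_def)
    qed
    then have "{x::real. x > 0 \<and> F \<omega> (of_real x) = 0 \<and> F1 \<omega> (of_real x) \<noteq> 0} \<in> null_sets lborel"
      by (rule countable_imp_null_set_lborel)
    then show "AE x in lborel. case (\<omega>, x) of (\<omega>, x) \<Rightarrow>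
        x > 0 \<longrightarrow> F \<omega> (of_real x) = 0 \<longrightarrow> F1 \<omega> (of_real x) = 0"
      by (rule AE_I') auto
  qed
qed

text \<open>Passing to the limit \<open>e \<rightarrow> 0\<close> in \<open>regular_mean_identity\<close>. Fatou's lemma bounds the integral of the kernel; this
makes four times the kernel an integrable majorant, and dominated convergence then gives equality.\<close>

lemma log_mean_identity:
  assumes c: "c > 0"
  shows "(\<integral>\<^sup>+ p. (case p of (\<omega>, x) \<Rightarrow> ennreal (max 0 (x - c) * kernel \<omega> (of_real x))) \<partial>(torus_haar \<Otimes>\<^sub>M lborel))
      = ennreal (log_mean c - ln (1 + cmod (a 1)))" (is "?I = ennreal ?D")
    and "ln (1 + cmod (a 1)) \<le> log_mean c"
proof -
  let ?P = "torus_haar \<Otimes>\<^sub>M (lborel :: real measure)"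
  define \<epsilon> where "\<epsilon> n = inverse (real (Suc n))" for n
  have \<epsilon>: "\<epsilon> n > 0" "\<epsilon> n \<le> 1" for n by (auto simp: \<epsilon>_def inverse_le_1_iff)
  have \<epsilon>0: "\<epsilon> \<longlonglongrightarrow> 0" unfolding \<epsilon>_def[abs_def] by (rule LIMSEQ_inverse_real_of_nat)
  define u where "u n = (\<lambda>(\<omega>, x). ennreal (max 0 (x - c) * density (\<epsilon> n) \<omega> x))" for n
  define v where "v = (\<lambda>(\<omega>, x). ennreal (max 0 (x - c) * kernel \<omega> (of_real x)))"
  have [measurable]: "u n \<in> borel_measurable ?P" "v \<in> borel_measurable ?P" for n
    unfolding u_def v_def by measurable
  have "(\<lambda>n. regular_mean (\<epsilon> n) c) \<longlonglongrightarrow> log_mean c"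
    using Lim_null_comparison[OF always_eventually \<epsilon>0, of "\<lambda>n. regular_mean (\<epsilon> n) c - log_mean c"]
      regular_mean_approx[OF \<epsilon>(1) c] by (simp add: LIM_zero_iff)
  moreover have "(\<lambda>n. psi (\<epsilon> n) ((cmod (a 1))\<^sup>2)) \<longlonglongrightarrow> ln (1 + cmod (a 1))"
    using Lim_null_comparison[OF always_eventually \<epsilon>0, of "\<lambda>n. psi (\<epsilon> n) ((cmod (a 1))\<^sup>2) - ln (1 + cmod (a 1))"]
      psi_approx[OF \<epsilon>(1)] by (simp add: LIM_zero_iff)
  ultimately have lim: "(\<lambda>n. regular_mean (\<epsilon> n) c - psi (\<epsilon> n) ((cmod (a 1))\<^sup>2)) \<longlonglongrightarrow> ?D"
    by (rule tendsto_diff)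
  have "0 \<le> ?D"
    using LIMSEQ_le_const[OF lim, of 0] regular_mean_identity(2)[OF \<epsilon>(1) c] by auto
  then show "ln (1 + cmod (a 1)) \<le> log_mean c" by simp
  have lim_int: "(\<lambda>n. \<integral>\<^sup>+ p. u n p \<partial>?P) \<longlonglongrightarrow> ennreal ?D"
    unfolding u_def regular_mean_identity(1)[OF \<epsilon>(1) c] by (rule tendsto_ennrealI[OF lim])
  have conv: "AE p in ?P. (\<lambda>n. u n p) \<longlonglongrightarrow> v p"
    using AE_zeros_degenerate
  proof eventually_elim
    case (elim p)
    obtain \<omega> x where p: "p = (\<omega>, x)" by (cases p)
    show ?case
    proof (cases "x > c")
      case True
      have "(\<lambda>n. density (\<epsilon> n) \<omega> x) \<longlonglongrightarrow> kernel \<omega> (of_real x)"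
      proof (cases "F \<omega> (of_real x) = 0")
        case 0: True
        then have "F1 \<omega> (of_real x) = 0" using elim True c by (simp add: p)
        then show ?thesis using 0 by (simp add: density_def kernel_def area_kernel_def)
      next
        case False
        have "(\<lambda>n. density (\<epsilon> n) \<omega> x) \<longlonglongrightarrow>
           lap 0 ((cmod (F \<omega> (of_real x)))\<^sup>2) * (cmod (F1 \<omega> (of_real x)))\<^sup>2"
          unfolding density_def using False \<epsilon>(1) \<epsilon>0
          by (intro tendsto_mult tendsto_lap tendsto_const) (auto intro: less_imp_le)
        then show ?thesis using lap_0[OF False] by (simp add: kernel_def)
      qed
      then show ?thesis
        unfolding u_def v_def p by (auto intro!: tendsto_ennrealI tendsto_mult)
    next
      case False
      then show ?thesis by (simp add: u_def v_def p max_def)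
    qed
  qed
  have "(\<integral>\<^sup>+ p. v p \<partial>?P) = (\<integral>\<^sup>+ p. liminf (\<lambda>n. u n p) \<partial>?P)"
    using conv by (intro nn_integral_cong_AE)
      (auto elim!: eventually_mono dest: lim_imp_Liminf[OF sequentially_bot])
  also have "\<dots> \<le> liminf (\<lambda>n. \<integral>\<^sup>+ p. u n p \<partial>?P)"
    by (rule nn_integral_liminf) measurable
  also have "\<dots> = ennreal ?D"
    by (rule lim_imp_Liminf[OF sequentially_bot lim_int])
  finally have fin: "(\<integral>\<^sup>+ p. v p \<partial>?P) < \<infinity>"
    by (simp add: less_top order_le_less_trans)
  have "(\<lambda>n. \<integral>\<^sup>+ p. u n p \<partial>?P) \<longlonglongrightarrow> (\<integral>\<^sup>+ p. v p \<partial>?P)"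
  proof (rule nn_integral_dominated_convergence[where w = "\<lambda>p. 4 * v p"])
    show "(\<integral>\<^sup>+ p. 4 * v p \<partial>?P) < \<infinity>"
      using fin by (simp add: nn_integral_cmult ennreal_mult_less_top)
    show "AE p in ?P. u n p \<le> 4 * v p" for n
      using AE_zeros_degenerate
    proof eventually_elim
      case (elim p)
      obtain \<omega> x where p: "p = (\<omega>, x)" by (cases p)
      show ?case
      proof (cases "x > c")
        case True
        have "density (\<epsilon> n) \<omega> x \<le> 4 * kernel \<omega> (of_real x)"
        proof (cases "F \<omega> (of_real x) = 0")
          case 0: True
          then have "F1 \<omega> (of_real x) = 0" using elim True c by (simp add: p)
          then show ?thesis by (simp add: density_def kernel_nonneg)
        next
          case False
          then show ?thesis unfolding density_def kernel_def by (rule lap_le_area_kernel[OF \<epsilon>])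
        qed
        then have "(x - c) * density (\<epsilon> n) \<omega> x \<le> (x - c) * (4 * kernel \<omega> (of_real x))"
          using True by (intro mult_left_mono) auto
        then have "u n p \<le> ennreal (4 * (max 0 (x - c) * kernel \<omega> (of_real x)))"
          unfolding u_def p using True by (auto intro!: ennreal_leI simp: max_def algebra_simps)
        also have "\<dots> = 4 * v p"
          by (subst ennreal_mult) (auto simp: v_def p kernel_nonneg)
        finally show ?thesis .
      qed (simp add: u_def p max_def)
    qed
  qed (use conv in auto)
  with lim_int have "(\<integral>\<^sup>+ p. v p \<partial>?P) = ennreal ?D" by (rule LIMSEQ_unique[rotated])
  then show "?I = ennreal ?D" by (simp add: v_def)
qed

definition area :: ennreal where
  "area = (\<integral>\<^sup>+ p. (case p of (\<omega>, x) \<Rightarrow> ennreal (max 0 x * kernel \<omega> (of_real x))) \<partial>(torus_haar \<Otimes>\<^sub>M lborel))"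

lemma log_mean_enn2ereal:
  assumes "c > 0"
  shows "ereal (log_mean c) = enn2ereal (ennreal (ln (1 + cmod (a 1))) +
    (\<integral>\<^sup>+ p. (case p of (\<omega>, x) \<Rightarrow> ennreal (max 0 (x - c) * kernel \<omega> (of_real x))) \<partial>(torus_haar \<Otimes>\<^sub>M lborel)))"
proof -
  have L: "0 \<le> ln (1 + cmod (a 1))" by simp
  show ?thesis
    unfolding log_mean_identity(1)[OF assms]
    using log_mean_identity(2)[OF assms] order_trans[OF L log_mean_identity(2)[OF assms]]
    by (subst ennreal_plus[symmetric]) (auto simp: enn2ereal_ennreal)
qed

text \<open>The integrals over \<open>x > c\<close> increase as \<open>c\<close> decreases to \<open>0\<close>, so the upper limit is a monotone limit, equal
to the integral over \<open>x > 0\<close> even if this is infinite.\<close>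

lemma nevanlinna_norm_eq:
  "nevanlinna_norm a = enn2ereal (ennreal (ln (1 + cmod (a 1))) + area)"
proof -
  let ?P = "torus_haar \<Otimes>\<^sub>M (lborel :: real measure)" and ?L = "ennreal (ln (1 + cmod (a 1)))"
  define I where "I c = (\<integral>\<^sup>+ p. (case p of (\<omega>, x) \<Rightarrow> ennreal (max 0 (x - c) * kernel \<omega> (of_real x))) \<partial>?P)" for c
  have lm: "ereal (log_mean c) = enn2ereal (?L + I c)" if "c > 0" for c
    unfolding I_def by (rule log_mean_enn2ereal[OF that])
  have anti: "I c \<le> I d" if "d \<le> c" for c d
    unfolding I_def using that
    by (intro nn_integral_mono) (auto intro!: ennreal_leI mult_right_mono kernel_nonneg)
  have area: "area = I 0" by (simp add: area_def I_def)
  have vm: "vertical_mean (\<lambda>x. ln (1 + x)) a c = log_mean c" if "c > 0" for c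
    unfolding log_mean_def using that
    by (intro vertical_mean_eq continuous_intros) auto
  have lim: "(\<lambda>n. I (inverse (real (Suc n)))) \<longlonglongrightarrow> I 0"
    unfolding I_def
  proof (rule nn_integral_LIMSEQ)
    show "incseq (\<lambda>n p. case p of (\<omega>, x) \<Rightarrow> ennreal (max 0 (x - inverse (real (Suc n))) * kernel \<omega> (of_real x)))"
    proof (rule incseq_SucI, rule le_funI, clarify)
      fix n :: nat and \<omega> :: "nat \<Rightarrow> complex" and x :: real
      have "inverse (real (Suc (Suc n))) \<le> inverse (real (Suc n))" by (intro le_imp_inverse_le) auto
      then show "ennreal (max 0 (x - inverse (real (Suc n))) * kernel \<omega> (of_real x))
         \<le> ennreal (max 0 (x - inverse (real (Suc (Suc n)))) * kernel \<omega> (of_real x))"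
        by (intro ennreal_leI mult_right_mono kernel_nonneg max.mono) auto
    qed
    show "(\<lambda>p. case p of (\<omega>, x) \<Rightarrow> ennreal (max 0 (x - inverse (real (Suc n))) * kernel \<omega> (of_real x))) \<in> borel_measurable ?P" for n
      by measurable
    show "(\<lambda>n. case p of (\<omega>, x) \<Rightarrow> ennreal (max 0 (x - inverse (real (Suc n))) * kernel \<omega> (of_real x)))
      \<longlonglongrightarrow> (case p of (\<omega>, x) \<Rightarrow> ennreal (max 0 (x - 0) * kernel \<omega> (of_real x)))" for p
    proof -
      have "(\<lambda>n. max 0 (x - inverse (real (Suc n))) * kernel \<omega> (of_real x)) \<longlonglongrightarrow> max 0 (x - 0) * kernel \<omega> (of_real x)"
        for \<omega> x
        by (intro tendsto_intros LIMSEQ_inverse_real_of_nat)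
      then show ?thesis by (cases p) (auto intro: tendsto_ennrealI)
    qed
  qed
  have "nevanlinna_norm a = Limsup (at_right 0) (\<lambda>\<sigma>. enn2ereal (?L + I \<sigma>))"
    unfolding nevanlinna_norm_def
    by (rule Limsup_eq, rule eventually_mono[OF eventually_at_right_less]) (simp add: vm lm)
  also have "\<dots> = enn2ereal (?L + I 0)"
  proof (rule antisym)
    show "Limsup (at_right 0) (\<lambda>\<sigma>. enn2ereal (?L + I \<sigma>)) \<le> enn2ereal (?L + I 0)"
      by (rule Limsup_bounded, rule eventually_mono[OF eventually_at_right_less])
         (auto simp: less_eq_ennreal.rep_eq[symmetric] intro!: add_left_mono anti)
    have lim': "(\<lambda>n. enn2ereal (?L + I (inverse (real (Suc n))))) \<longlonglongrightarrow> enn2ereal (?L + I 0)"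
      by (intro tendsto_enn2erealI tendsto_add tendsto_const lim)
    have bound: "enn2ereal (?L + I (inverse (real (Suc n)))) \<le> Limsup (at_right 0) (\<lambda>\<sigma>. enn2ereal (?L + I \<sigma>))" for n
    proof (rule le_Limsup)
      have "\<forall>\<^sub>F \<sigma> in at_right 0. \<sigma> < inverse (real (Suc n))"
        by (rule order_tendstoD(2)[OF tendsto_ident_at]) simp
      then show "\<forall>\<^sub>F \<sigma> in at_right 0. enn2ereal (?L + I (inverse (real (Suc n)))) \<le> enn2ereal (?L + I \<sigma>)"
        by eventually_elim (auto simp: less_eq_ennreal.rep_eq[symmetric] intro!: add_left_mono anti)
    qed simp
    show "enn2ereal (?L + I 0) \<le> Limsup (at_right 0) (\<lambda>\<sigma>. enn2ereal (?L + I \<sigma>))"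
      by (rule LIMSEQ_le_const2[OF lim']) (use bound in blast)
  qed
  finally show ?thesis by (simp add: area)
qed

lemma kernel_flow: "\<omega> \<in> space torus_haar \<Longrightarrow> kernel (flow t \<omega>) s = kernel \<omega> (s + \<i> * t)"
  by (simp add: kernel_def F_flow F1_flow)

text \<open>After exchanging the integrals, the innermost integral over the torus does not depend on \<open>t\<close>, so the
probability measure \<open>\<mu>\<close> integrates a constant.\<close>

lemma area_integral_eq:
  assumes \<mu>: "prob_space \<mu>" and [measurable_cong]: "sets \<mu> = sets borel"
  shows "area_integral \<mu> a = area"
proof -
  interpret \<mu>: prob_space \<mu> by fact
  interpret torus_\<mu>: pair_sigma_finite torus_haar \<mu> by unfold_locales
  define H where "H \<omega> \<sigma> t = ennreal (max 0 \<sigma> * kernel \<omega> (of_real \<sigma> + \<i> * of_real t))" for \<omega> \<sigma> and t :: real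
  have [measurable]: "(\<lambda>x. H (w x) (s x) (t x)) \<in> borel_measurable M"
    if [measurable]: "w \<in> M \<rightarrow>\<^sub>M torus_haar" "s \<in> borel_measurable M" "t \<in> borel_measurable M"
    for w :: "'m \<Rightarrow> _" and s t :: "'m \<Rightarrow> real" and M
    unfolding H_def by measurable
  have [simp]: "space \<mu> = UNIV" using sets_eq_imp_space_eq[OF assms(2)] by simp
  have inv: "(\<integral>\<^sup>+ \<omega>. H \<omega> \<sigma> t \<partial>torus_haar) = (\<integral>\<^sup>+ \<omega>. H \<omega> \<sigma> 0 \<partial>torus_haar)" for \<sigma> t
    by (subst nn_integral_flow[of "\<lambda>\<omega>. H \<omega> \<sigma> 0" t, symmetric])
       (auto intro!: nn_integral_cong simp: H_def kernel_flow)
  have H_eq: "(\<integral>\<^sup>+ t. ennreal ((cmod (deriv (F \<omega>) (Complex \<sigma> t)))\<^sup>2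
             / (cmod (F \<omega> (Complex \<sigma> t)) * (1 + cmod (F \<omega> (Complex \<sigma> t)))\<^sup>2) * \<sigma>)
         * indicator {t. F \<omega> (Complex \<sigma> t) \<noteq> 0} t \<partial>\<mu>) * indicator {0<..} \<sigma> = (\<integral>\<^sup>+ t. H \<omega> \<sigma> t \<partial>\<mu>)" for \<omega> \<sigma>
  proof (cases "\<sigma> > 0")
    case True
    then show ?thesis
      by (auto intro!: nn_integral_cong arg_cong[where f = ennreal]
          simp: H_def kernel_def area_kernel_def F1_def indicator_def Complex_eq mult.commute)
  qed (simp add: H_def max_def)
  have "area_integral \<mu> a = (\<integral>\<^sup>+ \<omega>. (\<integral>\<^sup>+ \<sigma>. (\<integral>\<^sup>+ t. H \<omega> \<sigma> t \<partial>\<mu>) \<partial>lborel) \<partial>torus_haar)"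
    unfolding area_integral_def H_eq ..
  also have "\<dots> = (\<integral>\<^sup>+ \<sigma>. (\<integral>\<^sup>+ \<omega>. (\<integral>\<^sup>+ t. H \<omega> \<sigma> t \<partial>\<mu>) \<partial>torus_haar) \<partial>lborel)"
    by (rule torus_line.Fubini'[symmetric]) measurable
  also have "\<dots> = (\<integral>\<^sup>+ \<sigma>. (\<integral>\<^sup>+ t. (\<integral>\<^sup>+ \<omega>. H \<omega> \<sigma> t \<partial>torus_haar) \<partial>\<mu>) \<partial>lborel)"
    by (intro nn_integral_cong torus_\<mu>.Fubini'[symmetric]) measurable
  also have "\<dots> = (\<integral>\<^sup>+ \<sigma>. (\<integral>\<^sup>+ \<omega>. H \<omega> \<sigma> 0 \<partial>torus_haar) \<partial>lborel)"
  proof (rule nn_integral_cong)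
    fix \<sigma> :: real
    have "(\<integral>\<^sup>+ t. (\<integral>\<^sup>+ \<omega>. H \<omega> \<sigma> t \<partial>torus_haar) \<partial>\<mu>) = (\<integral>\<^sup>+ t. (\<integral>\<^sup>+ \<omega>. H \<omega> \<sigma> 0 \<partial>torus_haar) \<partial>\<mu>)"
      by (rule nn_integral_cong) (rule inv)
    also have "\<dots> = (\<integral>\<^sup>+ \<omega>. H \<omega> \<sigma> 0 \<partial>torus_haar)"
      by (simp only: nn_integral_const \<mu>.emeasure_space_1 mult_1_right)
    finally show "(\<integral>\<^sup>+ t. (\<integral>\<^sup>+ \<omega>. H \<omega> \<sigma> t \<partial>torus_haar) \<partial>\<mu>) = (\<integral>\<^sup>+ \<omega>. H \<omega> \<sigma> 0 \<partial>torus_haar)" .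
  qed
  also have "\<dots> = (\<integral>\<^sup>+ p. (case p of (\<omega>, \<sigma>) \<Rightarrow> H \<omega> \<sigma> 0) \<partial>(torus_haar \<Otimes>\<^sub>M lborel))"
    using torus_line.nn_integral_snd[of "\<lambda>(\<omega>, \<sigma>). H \<omega> \<sigma> 0"] by simp
  also have "\<dots> = area"
    by (simp add: area_def H_def)
  finally show ?thesis .
qed

end

theorem theorem3p4:
  fixes \<mu> :: "real measure"
  assumes "prob_space \<mu>" and "sets \<mu> = sets borel"
  shows "\<exists>C::real. C \<ge> 1 \<and>
    (\<forall>a \<in> nevanlinna_class. (\<exists>s \<in> right_half_plane 0. dseries a s \<noteq> 0) \<longrightarrow>
      (\<forall>\<omega> \<in> space torus_haar.
        (let A = nevanlinna_norm a;
             B = ereal (ln (1 + cmod (dseries_at_infinity (twist a \<omega>))))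
                 + 4 * enn2ereal (area_integral \<mu> a)
         in ereal (inverse C) * A \<le> B \<and> B \<le> ereal C * A)))"
proof (intro exI[of _ 4] conjI ballI impI)
  fix a \<omega> assume a: "a \<in> nevanlinna_class" and \<omega>: "\<omega> \<in> space torus_haar"
  then interpret unif_dirichlet a by unfold_locales (simp add: nevanlinna_class_def)
  define L where "L = ennreal (ln (1 + cmod (a 1)))"
  have "ereal (ln (1 + cmod (a 1))) = enn2ereal L" by (simp add: L_def enn2ereal_ennreal)
  then have B: "ereal (ln (1 + cmod (dseries_at_infinity (twist a \<omega>)))) + 4 * enn2ereal (area_integral \<mu> a)
      = enn2ereal (L + 4 * area)"
    using \<omega> by (simp add: dseries_at_infinity_twist area_integral_eq[OF assms]
        plus_ennreal.rep_eq times_ennreal.rep_eq)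
  have A: "nevanlinna_norm a = enn2ereal (L + area)" by (simp add: nevanlinna_norm_eq L_def)
  have "ereal (inverse 4) * enn2ereal (L + area) \<le> enn2ereal (L + area)"
    using ereal_mult_right_mono[of "ereal (inverse 4)" 1 "enn2ereal (L + area)"] by simp
  also have "\<dots> \<le> enn2ereal (L + 4 * area)"
    unfolding less_eq_ennreal.rep_eq[symmetric]
    using mult_right_mono[of 1 4 area] by (intro add_left_mono) simp
  finally have 1: "ereal (inverse 4) * enn2ereal (L + area) \<le> enn2ereal (L + 4 * area)" .
  have "L + 4 * area \<le> 4 * (L + area)"
    unfolding distrib_left using mult_right_mono[of 1 4 L] by (intro add_right_mono) simp
  then have "enn2ereal (L + 4 * area) \<le> enn2ereal (4 * (L + area))"
    unfolding less_eq_ennreal.rep_eq .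
  also have "enn2ereal (4 * (L + area)) = ereal 4 * enn2ereal (L + area)"
    unfolding times_ennreal.rep_eq by simp
  finally have 2: "enn2ereal (L + 4 * area) \<le> ereal 4 * enn2ereal (L + area)" .
  show "let A = nevanlinna_norm a;
             B = ereal (ln (1 + cmod (dseries_at_infinity (twist a \<omega>))))
                 + 4 * enn2ereal (area_integral \<mu> a)
         in ereal (inverse 4) * A \<le> B \<and> B \<le> ereal 4 * A"
    unfolding Let_def B A using 1 2 by blast
qed simp

end
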